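(* Let $(\mathcal{A},\varphi)$ be a $*$-probability space. Let $(a_n)_{n=1}^\infty$ be an exchangeable sequence of selfadjoint elements of $\mathcal{A}$, with associated function on partitions $\mathbf{t} : \sqcup_{k=1}^\infty\mathcal{P}(k)\to\mathbb{C}$, such that $\mathbf{t}(\pi)=0$ whenever the partition $\pi\in\sqcup_{k=1}^\infty\mathcal{P}(k)$ has at least one block $V$ with $|V|=1$. Pick $\lambda\in\mathbb{R}$ and put $b_n := a_n+\lambda$, $n\in\mathbb{N}$. This creates a new exchangeable sequence $(b_n)_{n=1}^\infty$, which also has an associated function on partitions, $\mathbf{u} : \sqcup_{k=1}^\infty\mathcal{P}(k)\to\mathbb{C}$. Let $\mu,\nu : \mathbb{C}\langle\{X_p\mid p\in\mathbb{N}\}\rangle\to\mathbb{C}$ be the linear functionals determined by $\mu(1)=\nu(1)=1$ and, for all $k\in\mathbb{N}$ and $\underline{i}=(\underline{i}(1),\ldots,\underline{i}(k))\in\mathbb{N}^k$, $$\mu(X_{\underline{i}(1)}\cdots X_{\underline{i}(k)})=\sum_{\pi\in\mathcal{P}_2(k),\ \pi\le\mathrm{Ker}(\underline{i})}\mathbf{t}(\pi),\qquad \nu(X_{\underline{i}(1)}\cdots X_{\underline{i}(k)})=\sum_{\pi\in\mathcal{P}_2(k),\ \pi\le\mathrm{Ker}(\underline{i})}\mathbf{u}(\pi)$$ (empty sums being $0$). Finally, pick $r\in\mathbb{N}$ and let $f,g$ denote the commuting exponential generating functions of the functionals $\mu\mid\mathbb{C}\langle X_1,\ldots,X_r\rangle$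 and respectively $\nu\mid\mathbb{C}\langle X_1,\ldots,X_r\rangle$. Then $$f(z_1,\ldots,z_r)\cdot e^{\lambda^2(z_1^2+\cdots+z_r^2)/2}=g(z_1,\ldots,z_r).$$
   Context: $\mathbb{N}=\{1,2,\ldots\}$. A $*$-probability space is a pair $(\mathcal{A},\varphi)$ with $\mathcal{A}$ a unital $*$-algebra over $\mathbb{C}$ and $\varphi:\mathcal{A}\to\mathbb{C}$ a positive linear functional with $\varphi(1)=1$; $a_n+\lambda$ means $a_n+\lambda 1_{\mathcal{A}}$. $\mathcal{P}(k)$ is the set of partitions of $\{1,\ldots,k\}$ ordered by reverse refinement ($\pi\le\rho$ iff every block of $\pi$ is contained in a block of $\rho$); $\mathcal{P}_2(k)$ is the set of those with all blocks of cardinality $2$ (empty for $k$ odd). For $\underline{i}\in\mathbb{N}^k$, $\mathrm{Ker}(\underline{i})\in\mathcal{P}(k)$ is the partition of $\{1,\ldots,k\}$ into level sets of $\underline{i}$. A sequence $(a_n)$ of selfadjoint elements is exchangeable if $\varphi(a_{\underline{i}(1)}\cdots a_{\underline{i}(k)})=\varphi(a_{\underline{j}(1)}\cdots a_{\underline{j}(k)})$ for all $k\in\mathbb{N}$ and all $\underline{i},\underline{j}\in\mathbb{N}^k$ with $\mathrm{Ker}(\underline{i})=\mathrm{Ker}(\underline{j})$; its associated function on partitions is $\mathbf{t}(\pi):=\varphi(a_{\underline{i}(1)}\cdots a_{\underline{i}(k)})$ for $\pi\in\mathcal{P}(k)$ and any $\underline{i}\in\mathbb{N}^k$ with $\mathrm{Ker}(\underline{i})=\pi$.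 $\mathbb{C}\langle\cdots\rangle$ denotes the algebra of polynomials in non-commuting indeterminates. For a linear functional $\mu$ on $\mathbb{C}\langle X_1,\ldots,X_r\rangle$ with $\mu(1)=1$, its commuting exponential generating function is the power series in commuting indeterminates $z_1,\ldots,z_r$ $$1+\sum_{k=1}^\infty\sum_{i(1),\ldots,i(k)=1}^r\frac{\mu(X_{i(1)}\cdots X_{i(k)})}{k!}z_{i(1)}\cdots z_{i(k)}.$$ *)

theory Defs
  imports
    Complex_Main
    "HOL-Library.Multiset"
    "HOL-Library.Disjoint_Sets"
    "HOL-Library.Groups_Big_Fun"
    "HOL-Library.Poly_Mapping"
    "HOL-Library.Nonpos_Ints"
begin

(* Indexing convention: positions 1,...,k and labels 1,2,... of the source are shifted to
   0,...,k-1 and 0,1,2,...; a tuple of length k over the labels is a nat list of length k. *)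

section \<open>Star-probability spaces\<close>

locale star_algebra = vector_space scale
  for scale :: "complex \<Rightarrow> 'a::ring_1 \<Rightarrow> 'a" +
  fixes star :: "'a \<Rightarrow> 'a"
  assumes scale_mult_left: "scale c (x * y) = scale c x * y"
    and scale_mult_right: "scale c (x * y) = x * scale c y"
    and star_star: "star (star x) = x"
    and star_add: "star (x + y) = star x + star y"
    and star_scale: "star (scale c x) = scale (cnj c) (star x)"
    and star_mult: "star (x * y) = star y * star x"

locale star_prob_space = star_algebra scale star
  for scale :: "complex \<Rightarrow> 'a::ring_1 \<Rightarrow> 'a" and star :: "'a \<Rightarrow> 'a" +
  fixes \<phi> :: "'a \<Rightarrow> complex"
  assumes linear_state: "Vector_Spaces.linear scale (*) \<phi>"
    and state_nonneg: "\<phi> (star x * x) \<in> \<real>\<^sub>\<ge>\<^sub>0"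
    and state_one: "\<phi> 1 = 1"


section \<open>Partitions and exchangeable sequences\<close>

definition pair_partitions :: "nat \<Rightarrow> nat set set set" where
  "pair_partitions k = {\<pi>. partition_on {..<k} \<pi> \<and> (\<forall>V\<in>\<pi>. card V = 2)}"

definition ker :: "'i list \<Rightarrow> nat set set" where
  "ker is = (\<lambda>v. {p. p < length is \<and> is ! p = v}) ` set is"

lemma partition_on_ker: "partition_on {..<length is} (ker is)"
  unfolding ker_def by (rule partition_onI) (auto simp: in_set_conv_nth disjnt_def)

lemma ex_ker:
  assumes "partition_on {..<k} \<pi>"
  shows "\<exists>is::nat list. length is = k \<and> ker is = \<pi>"
proof -
  have ex: "\<exists>!V. V \<in> \<pi> \<and> p \<in> V" if "p < k" for p
  proof -
    have "p \<in> \<Union>\<pi>" using that partition_onD1[OF assms] by (metis lessThan_iff)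
    then obtain V where "V \<in> \<pi>" "p \<in> V" by (rule UnionE)
    then show ?thesis
      using partition_onD2[OF assms] unfolding disjoint_def by blast
  qed
  define B where "B p = (THE V. V \<in> \<pi> \<and> p \<in> V)" for p
  have B: "B p \<in> \<pi>" "p \<in> B p" if "p < k" for p
    using theI'[OF ex[OF that]] unfolding B_def by blast+
  have B_eq: "B p = V" if "V \<in> \<pi>" "p \<in> V" for p V
  proof -
    have "p < k" using assms that by (auto simp: partition_on_def)
    then show ?thesis using ex[of p] B[of p] that by blast
  qed
  define "is" where "is = map (\<lambda>p. Min (B p)) [0..<k]"
  have nonempty: "V \<noteq> {}" and sub: "V \<subseteq> {..<k}" if "V \<in> \<pi>" for V
    using assms that by (auto simp: partition_on_def)
  have fin: "finite V" if "V \<in> \<pi>" for V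
    using sub[OF that] finite_subset by blast
  have level: "{p. p < length is \<and> is ! p = is ! q} = B q" if "q < k" for q
  proof (intro set_eqI iffI)
    fix p assume "p \<in> {p. p < length is \<and> is ! p = is ! q}"
    then have p: "p < k" and "Min (B p) = Min (B q)" using that by (auto simp: is_def)
    moreover have "Min (B p) \<in> B p" by (rule Min_in[OF fin[OF B(1)[OF p]] nonempty[OF B(1)[OF p]]])
    moreover have "Min (B q) \<in> B q" by (rule Min_in[OF fin[OF B(1)[OF that]] nonempty[OF B(1)[OF that]]])
    ultimately have "B p = B q" using B_eq[OF B(1)[OF p]] B_eq[OF B(1)[OF that]] by metis
    then show "p \<in> B q" using B(2)[OF p] by simp
  next
    fix p assume p: "p \<in> B q"
    then have "p < k" using sub B(1)[OF that] by blast
    moreover have "B p = B q" using B_eq B(1)[OF that] p by blast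
    ultimately show "p \<in> {p. p < length is \<and> is ! p = is ! q}" using that by (simp add: is_def)
  qed
  have "ker is = (\<lambda>q. {p. p < length is \<and> is ! p = is ! q}) ` {..<k}"
  proof -
    have "set is = (\<lambda>q. is ! q) ` {..<k}" by (force simp: in_set_conv_nth is_def)
    then show ?thesis unfolding ker_def by (simp add: image_image)
  qed
  also have "\<dots> = B ` {..<k}" using level by auto
  also have "\<dots> = \<pi>"
  proof
    show "B ` {..<k} \<subseteq> \<pi>" using B by auto
    show "\<pi> \<subseteq> B ` {..<k}"
    proof
      fix V assume V: "V \<in> \<pi>"
      then obtain p where "p \<in> V" using nonempty by blast
      then show "V \<in> B ` {..<k}" using B_eq[OF V] sub[OF V] by blast
    qed
  qed
  finally show ?thesis by (intro exI[of _ "is"]) (simp add: is_def)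
qed

definition exchangeable ::
    "('a::ring_1 \<Rightarrow> 'a) \<Rightarrow> ('a \<Rightarrow> complex) \<Rightarrow> (nat \<Rightarrow> 'a) \<Rightarrow> bool" where
  "exchangeable star \<phi> a \<longleftrightarrow>
     (\<forall>n. star (a n) = a n) \<and>
     (\<forall>k\<ge>1. \<forall>is js. length is = k \<and> length js = k \<and> ker is = ker js \<longrightarrow>
        \<phi> (prod_list (map a is)) = \<phi> (prod_list (map a js)))"

(* The length k need not be an argument: a partition of {..<k} determines k.
   Independence of the chosen tuple is partition_function_ker below. *)
definition partition_function ::
    "('a::ring_1 \<Rightarrow> complex) \<Rightarrow> (nat \<Rightarrow> 'a) \<Rightarrow> nat set set \<Rightarrow> complex" where
  "partition_function \<phi> a \<pi> = \<phi> (prod_list (map a (SOME is. ker is = \<pi>)))"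

lemma length_eq_if_ker_eq:
  assumes "ker is = ker js"
  shows "length is = length js"
  using partition_on_ker[of "is"] partition_on_ker[of js] assms
  by (metis partition_onD1 lessThan_eq_iff)

lemma partition_function_ker:
  assumes "exchangeable star \<phi> a" "is \<noteq> []"
  shows "partition_function \<phi> a (ker is) = \<phi> (prod_list (map a is))"
proof -
  define js where "js = (SOME js::nat list. ker js = ker is)"
  have js: "ker js = ker is" unfolding js_def by (rule someI[of _ "is"]) simp
  moreover have "length is \<ge> 1" using assms(2) by (cases "is") auto
  ultimately have "\<phi> (prod_list (map a js)) = \<phi> (prod_list (map a is))"
    using assms(1) length_eq_if_ker_eq[OF js] unfolding exchangeable_def by metis
  then show ?thesis unfolding partition_function_def js_def .
qed


section \<open>Non-commutative polynomials\<close>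

datatype 'v nc_word = Word (letters: "'v list")

instantiation nc_word :: (type) monoid_add
begin

definition zero_nc_word :: "'a nc_word" where
  "0 = Word []"

definition plus_nc_word :: "'a nc_word \<Rightarrow> 'a nc_word \<Rightarrow> 'a nc_word" where
  "v + w = Word (letters v @ letters w)"

instance
  by standard (simp_all add: zero_nc_word_def plus_nc_word_def)

end

(* The monoid algebra of the free monoid; Poly_Mapping supplies the convolution product. *)
type_synonym 'v nc_poly = "'v nc_word \<Rightarrow>\<^sub>0 complex"

definition nc_var :: "'v \<Rightarrow> 'v nc_poly" where
  "nc_var v = Poly_Mapping.single (Word [v]) 1"

definition nc_scale :: "complex \<Rightarrow> 'v nc_poly \<Rightarrow> 'v nc_poly" where
  "nc_scale c = Poly_Mapping.map ((*) c)"

lemma lookup_nc_scale: "Poly_Mapping.lookup (nc_scale c p) w = c * Poly_Mapping.lookup p w"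
  by (simp add: nc_scale_def map.rep_eq when_def)

lemma vector_space_nc_scale: "vector_space (nc_scale :: complex \<Rightarrow> 'v nc_poly \<Rightarrow> 'v nc_poly)"
  by unfold_locales
    (auto intro!: poly_mapping_eqI simp: lookup_nc_scale lookup_add algebra_simps)

lemma prod_list_nc_var: "prod_list (map nc_var vs) = Poly_Mapping.single (Word vs) 1"
proof (induction vs)
  case Nil
  then show ?case by (simp add: zero_nc_word_def[symmetric])
next
  case (Cons v vs)
  then show ?case by (simp add: nc_var_def mult_single plus_nc_word_def)
qed

definition is_pairing_functional ::
    "(nat set set \<Rightarrow> complex) \<Rightarrow> (nat nc_poly \<Rightarrow> complex) \<Rightarrow> bool" where
  "is_pairing_functional t \<mu> \<longleftrightarrow>
     Vector_Spaces.linear nc_scale (*) \<mu> \<and> \<mu> 1 = 1 \<and>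
     (\<forall>k\<ge>1. \<forall>is. length is = k \<longrightarrow>
        \<mu> (prod_list (map nc_var is)) =
          (\<Sum>\<pi> | \<pi> \<in> pair_partitions k \<and> refines {..<k} \<pi> (ker is). t \<pi>))"

lemma linear_functional_on_words:
  fixes v :: "'v list \<Rightarrow> complex"
  shows "\<exists>!\<mu>. Vector_Spaces.linear nc_scale (*) \<mu> \<and> (\<forall>vs. \<mu> (prod_list (map nc_var vs)) = v vs)"
proof (rule ex_ex1I)
  define \<mu> where "\<mu> p = (\<Sum>w\<in>Poly_Mapping.keys p. Poly_Mapping.lookup p w * v (letters w))" for p
  have \<mu>: "\<mu> p = (\<Sum>w\<in>A. Poly_Mapping.lookup p w * v (letters w))"
    if "finite A" "Poly_Mapping.keys p \<subseteq> A" for A p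
    unfolding \<mu>_def using that by (intro sum.mono_neutral_left) (auto simp: in_keys_iff)
  have "\<mu> (p + q) = \<mu> p + \<mu> q" for p q
  proof -
    let ?A = "Poly_Mapping.keys p \<union> Poly_Mapping.keys q"
    have "Poly_Mapping.keys (p + q) \<subseteq> ?A" by (rule Poly_Mapping.keys_add)
    then show ?thesis
      using \<mu>[of ?A p] \<mu>[of ?A q] \<mu>[of ?A "p + q"]
      by (simp add: lookup_add sum.distrib algebra_simps)
  qed
  moreover have "\<mu> (nc_scale c p) = c * \<mu> p" for c p
  proof -
    have "Poly_Mapping.keys (nc_scale c p) \<subseteq> Poly_Mapping.keys p"
      by (auto simp: in_keys_iff lookup_nc_scale)
    then show ?thesis
      using \<mu>[of "Poly_Mapping.keys p" p] \<mu>[of "Poly_Mapping.keys p" "nc_scale c p"]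
      by (simp add: lookup_nc_scale sum_distrib_left algebra_simps)
  qed
  moreover have "vector_space ((*) :: complex \<Rightarrow> complex \<Rightarrow> complex)"
    by unfold_locales (auto simp: algebra_simps)
  ultimately have "Vector_Spaces.linear nc_scale (*) \<mu>"
    by (intro Vector_Spaces.linear.intro module_hom.intro module_hom_axioms.intro)
      (auto simp: vector_space_nc_scale module_iff_vector_space)
  moreover have "\<mu> (prod_list (map nc_var vs)) = v vs" for vs
    by (simp add: prod_list_nc_var \<mu>_def)
  ultimately show "\<exists>\<mu>. Vector_Spaces.linear nc_scale (*) \<mu> \<and>
      (\<forall>vs. \<mu> (prod_list (map nc_var vs)) = v vs)" by blast
next
  fix \<mu> \<nu> :: "'v nc_poly \<Rightarrow> complex"
  assume \<mu>: "Vector_Spaces.linear nc_scale (*) \<mu> \<and> (\<forall>vs. \<mu> (prod_list (map nc_var vs)) = v vs)"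
    and \<nu>: "Vector_Spaces.linear nc_scale (*) \<nu> \<and> (\<forall>vs. \<nu> (prod_list (map nc_var vs)) = v vs)"
  interpret m: Vector_Spaces.linear nc_scale "(*)" \<mu> using \<mu> by simp
  interpret n: Vector_Spaces.linear nc_scale "(*)" \<nu> using \<nu> by simp
  have single: "Poly_Mapping.single w c = nc_scale c (prod_list (map nc_var (letters w)))"
    for w :: "'v nc_word" and c
    by (rule poly_mapping_eqI) (simp add: prod_list_nc_var lookup_nc_scale lookup_single when_def)
  have "\<mu> p = \<nu> p" for p
  proof -
    have p: "p = (\<Sum>w\<in>Poly_Mapping.keys p. Poly_Mapping.single w (Poly_Mapping.lookup p w))"
      by (rule poly_mapping_eqI) (simp add: lookup_sum lookup_single when_def in_keys_iff)
    show ?thesis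
      by (subst (1 2) p) (simp add: m.sum n.sum single m.scale n.scale \<mu> \<nu>)
  qed
  then show "\<mu> = \<nu>" by blast
qed

lemma ex1_pairing_functional: "\<exists>!\<mu>. is_pairing_functional t \<mu>"
proof -
  define v where "v is = (if is = [] then 1 else
    (\<Sum>\<pi> | \<pi> \<in> pair_partitions (length is) \<and> refines {..<length is} \<pi> (ker is). t \<pi>))"
    for "is" :: "nat list"
  have "is_pairing_functional t = (\<lambda>\<mu>. Vector_Spaces.linear nc_scale (*) \<mu> \<and>
      (\<forall>vs. \<mu> (prod_list (map nc_var vs)) = v vs))"
  proof
    fix \<mu>
    have "(\<mu> 1 = 1 \<and> (\<forall>k\<ge>1. \<forall>is. length is = k \<longrightarrow> \<mu> (prod_list (map nc_var is)) =
        (\<Sum>\<pi> | \<pi> \<in> pair_partitions k \<and> refines {..<k} \<pi> (ker is). t \<pi>))) \<longleftrightarrow>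
        (\<forall>vs. \<mu> (prod_list (map nc_var vs)) = v vs)" (is "?L \<longleftrightarrow> ?R")
    proof
      assume ?L
      then show ?R
        by (intro allI, rename_tac vs, case_tac "vs = []") (auto simp: v_def Suc_le_eq)
    next
      assume R: ?R
      have "\<mu> 1 = 1" using R[rule_format, of "[]"] by (simp add: v_def)
      then show ?L using R by (auto simp: v_def)
    qed
    then show "is_pairing_functional t \<mu> = (Vector_Spaces.linear nc_scale (*) \<mu> \<and>
      (\<forall>vs. \<mu> (prod_list (map nc_var vs)) = v vs))"
      unfolding is_pairing_functional_def by simp
  qed
  then show ?thesis using linear_functional_on_words[of v] by simp
qed


section \<open>Formal power series in several commuting indeterminates\<close>

(* A monomial is the multiset of its indeterminates, so that z(i1)...z(ik) is mset [i1,...,ik]. *)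
typedef ('v, 'a) mfps = "UNIV :: ('v multiset \<Rightarrow> 'a) set"
  morphisms mfps_coeff Mfps ..

setup_lifting type_definition_mfps

lemma mfps_eqI: "(\<And>M. mfps_coeff f M = mfps_coeff g M) \<Longrightarrow> f = g"
  by transfer auto

lemma finite_submultisets: "finite {A. A \<subseteq># M}"
proof (induction M)
  case empty
  then show ?case by simp
next
  case (add x M)
  have "A \<in> {A. A \<subseteq># M} \<union> add_mset x ` {A. A \<subseteq># M}" if A: "A \<subseteq># add_mset x M" for A
  proof -
    have "A - {#x#} \<subseteq># M" using A by (simp add: subset_eq_diff_conv)
    then show ?thesis
      by (cases "x \<in># A") (metis UnI2 imageI insert_DiffM mem_Collect_eq, simp add: diff_single_trivial)
  qed
  then have "{A. A \<subseteq># add_mset x M} \<subseteq> {A. A \<subseteq># M} \<union> add_mset x ` {A. A \<subseteq># M}" by blast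
  then show ?case using add by (meson finite_Un finite_imageI finite_subset)
qed

lemma submultiset_diff: "B \<subseteq># A \<Longrightarrow> A \<subseteq># M \<Longrightarrow> A - B \<subseteq># M - B"
  by (simp add: subseteq_mset_def diff_le_mono)

lemma submultiset_add: "A \<subseteq># M \<Longrightarrow> B \<subseteq># M - A \<Longrightarrow> A + B \<subseteq># M"
  by (metis subset_mset.add_diff_inverse mset_subset_eq_mono_add_left_cancel)

instantiation mfps :: (type, comm_ring_1) comm_ring_1
begin

lift_definition zero_mfps :: "('a, 'b) mfps" is "\<lambda>_. 0" .

lift_definition one_mfps :: "('a, 'b) mfps" is "\<lambda>M. if M = {#} then 1 else 0" .

lift_definition plus_mfps :: "('a, 'b) mfps \<Rightarrow> ('a, 'b) mfps \<Rightarrow> ('a, 'b) mfps"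
  is "\<lambda>f g M. f M + g M" .

lift_definition minus_mfps :: "('a, 'b) mfps \<Rightarrow> ('a, 'b) mfps \<Rightarrow> ('a, 'b) mfps"
  is "\<lambda>f g M. f M - g M" .

lift_definition uminus_mfps :: "('a, 'b) mfps \<Rightarrow> ('a, 'b) mfps"
  is "\<lambda>f M. - f M" .

lift_definition times_mfps :: "('a, 'b) mfps \<Rightarrow> ('a, 'b) mfps \<Rightarrow> ('a, 'b) mfps"
  is "\<lambda>f g M. \<Sum>A | A \<subseteq># M. f A * g (M - A)" .

instance
proof
  fix f g h :: "('a, 'b) mfps"
  show "f * g * h = f * (g * h)"
  proof (transfer, rule ext)
    fix f g h :: "'a multiset \<Rightarrow> 'b" and M
    have "(\<Sum>A | A \<subseteq># M. (\<Sum>B | B \<subseteq># A. f B * g (A - B)) * h (M - A)) =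
        (\<Sum>(A, B)\<in>(SIGMA A:{A. A \<subseteq># M}. {B. B \<subseteq># A}). f B * g (A - B) * h (M - A))"
      by (simp add: sum_distrib_right sum.Sigma finite_submultisets)
    also have "\<dots> = (\<Sum>(A, B)\<in>(SIGMA A:{A. A \<subseteq># M}. {B. B \<subseteq># M - A}).
        f A * g B * h (M - A - B))"
      by (rule sum.reindex_bij_witness[of _ "\<lambda>(A, B). (A + B, A)" "\<lambda>(A, B). (B, A - B)"])
        (auto simp: diff_diff_add_mset subset_mset.add_diff_inverse
          intro: submultiset_diff submultiset_add subset_mset.order_trans)
    also have "\<dots> = (\<Sum>A | A \<subseteq># M. f A * (\<Sum>B | B \<subseteq># M - A. g B * h (M - A - B)))"
      by (simp add: sum_distrib_left sum.Sigma finite_submultisets mult.assoc)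
    finally show "(\<Sum>A | A \<subseteq># M. (\<Sum>B | B \<subseteq># A. f B * g (A - B)) * h (M - A)) =
        (\<Sum>A | A \<subseteq># M. f A * (\<Sum>B | B \<subseteq># M - A. g B * h (M - A - B)))" .
  qed
  show "f * g = g * f"
  proof (transfer, rule ext)
    fix f g :: "'a multiset \<Rightarrow> 'b" and M
    show "(\<Sum>A | A \<subseteq># M. f A * g (M - A)) = (\<Sum>A | A \<subseteq># M. g A * f (M - A))"
      by (rule sum.reindex_bij_witness[of _ "\<lambda>A. M - A" "\<lambda>A. M - A"])
        (auto simp: mult.commute subset_mset.diff_diff_right)
  qed
  show "1 * f = f"
  proof (transfer, rule ext)
    fix f :: "'a multiset \<Rightarrow> 'b" and M
    have "(\<Sum>A | A \<subseteq># M. (if A = {#} then 1 else 0) * f (M - A)) =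
        (\<Sum>A | A \<subseteq># M. if A = {#} then f M else 0)"
      by (intro sum.cong) auto
    then show "(\<Sum>A | A \<subseteq># M. (if A = {#} then 1 else 0) * f (M - A)) = f M"
      by (simp add: finite_submultisets)
  qed
  show "(f + g) * h = f * h + g * h"
    by transfer (simp add: distrib_right sum.distrib)
  show "(0 :: ('a, 'b) mfps) \<noteq> 1"
    by transfer (metis zero_neq_one)
qed (transfer; simp add: algebra_simps)+

end

lift_definition mfps_const :: "'a::comm_ring_1 \<Rightarrow> ('v, 'a) mfps"
  is "\<lambda>c M. if M = {#} then c else 0" .

lift_definition mfps_var :: "'v \<Rightarrow> ('v, 'a::comm_ring_1) mfps"
  is "\<lambda>v M. if M = {#v#} then 1 else 0" .

(* Coefficientwise sum of a sequence of series; meaningful when every monomial occurs in only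
   finitely many of them, which holds in both uses below. Elsewhere Sum_any gives the junk value 0. *)
lift_definition mfps_suminf :: "(nat \<Rightarrow> ('v, 'a::comm_ring_1) mfps) \<Rightarrow> ('v, 'a) mfps"
  is "\<lambda>F M. Sum_any (\<lambda>n. F n M)" .

(* For series h with zero constant term. *)
definition mfps_exp :: "('v, complex) mfps \<Rightarrow> ('v, complex) mfps" where
  "mfps_exp h = mfps_suminf (\<lambda>n. mfps_const (1 / fact n) * h ^ n)"

(* Depends only on the restriction of \<mu> to the subalgebra generated by the first r
   indeterminates. The result lives in the ring of series over all z(0), z(1), ..., but involves
   only z(0), ..., z(r-1). *)
definition comm_exp_gen_fun :: "nat \<Rightarrow> (nat nc_poly \<Rightarrow> complex) \<Rightarrow> (nat, complex) mfps" where
  "comm_exp_gen_fun r \<mu> =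
     1 + mfps_suminf (\<lambda>k. if k = 0 then 0 else
           \<Sum>is | length is = k \<and> set is \<subseteq> {..<r}.
             mfps_const (\<mu> (prod_list (map nc_var is)) / fact k) * prod_list (map mfps_var is))"

end

(* Put s = z_1^2 + ... + z_r^2 and T_k = sum of t(pi) over all pairings pi of k points. For a
   fixed pairing with m blocks, the monomials of the words constant on its blocks add up to s^m;
   hence f = sum_m T_(2m)/(2m)! s^m, and likewise g = sum_m U_(2m)/(2m)! s^m for u,
   so only a one-variable identity between the numbers T and U is left.
   A pairing of 2m points is the kernel of exactly m! words using each of the m letters 0,...,m-1
   twice, so m! T_(2m) is the sum of phi(a_w) over these words, and m! U_(2m) that of phi(b_w).
   Expanding b_w = product of (a + l) over position subsets, only the subwords in which every letter
   still occurs twice contribute, because words with an isolated letter vanish. Counting the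
   ways to choose the subword and to fill up the remaining positions gives
   U_(2m)/(2m)! = sum_j T_(2j)/(2j)! (l^2/2)^(m-j)/(m-j)!, a Cauchy product. *)
theory Submission
  imports Defs "HOL-Library.FuncSet" "HOL-Combinatorics.Multiset_Permutations"
begin

section \<open>Words, kernels and pairings\<close>

lemma block_in_ker: "p < length w \<Longrightarrow> {q. q < length w \<and> w ! q = w ! p} \<in> ker w"
  by (auto simp: ker_def)

lemma ker_map_inj:
  assumes "inj_on h (set w)"
  shows "ker (map h w) = ker w"
  unfolding ker_def set_map image_image
proof (rule image_cong[OF refl])
  fix v assume "v \<in> set w"
  then show "{p. p < length (map h w) \<and> map h w ! p = h v} = {p. p < length w \<and> w ! p = v}"
    using assms by (auto simp: inj_on_def)
qed

lemma ker_eqD: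
  assumes "ker v = ker w" "p < length v" "q < length v" "v ! p = v ! q"
  shows "w ! p = w ! q"
proof -
  have "{i. i < length v \<and> v ! i = v ! q} \<in> ker w"
    using block_in_ker[OF assms(3)] assms(1) by simp
  then obtain x where "{i. i < length v \<and> v ! i = v ! q} = {i. i < length w \<and> w ! i = x}"
    by (auto simp: ker_def)
  then have "p \<in> {i. i < length w \<and> w ! i = x}" "q \<in> {i. i < length w \<and> w ! i = x}"
    using assms by blast+
  then show ?thesis by simp
qed

text \<open>Equal kernels mean the same coincidences between positions, so sending each letter of
  \<open>v\<close> to the letter of \<open>w\<close> at the same position is well defined and
  injective. This turns the kernel condition of exchangeability into invariance under injective
  renaming.\<close>

lemma ker_eq_relabel:
  assumes "ker v = ker w"
  obtains h where "inj_on h (set v)" "w = map h v"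
proof
  \<comment> \<open>\<open>i x\<close> is some position of the letter \<open>x\<close> in
    \<open>v\<close>; by \<open>ker_eqD\<close> the choice does not affect the letter read from
    \<open>w\<close>.\<close>
  define i where "i x = (SOME p. p < length v \<and> v ! p = x)" for x
  have i: "i x < length v" "v ! i x = x" if "x \<in> set v" for x
    using that someI_ex[of "\<lambda>p. p < length v \<and> v ! p = x"]
    unfolding i_def by (auto simp: in_set_conv_nth)
  have len: "length v = length w" using assms by (rule length_eq_if_ker_eq)
  show "w = map (\<lambda>x. w ! i x) v"
  proof (rule nth_equalityI)
    fix p assume "p < length w"
    then show "w ! p = map (\<lambda>x. w ! i x) v ! p"
      using ker_eqD[OF assms, of p "i (v ! p)"] i[of "v ! p"] len by simp
  qed (simp add: len)
  show "inj_on (\<lambda>x. w ! i x) (set v)"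
  proof (rule inj_onI)
    fix x y assume "x \<in> set v" "y \<in> set v" "w ! i x = w ! i y"
    then show "x = y" using ker_eqD[OF assms[symmetric], of "i x" "i y"] i len by metis
  qed
qed

lemma card_level_set: "card {p. p < length w \<and> w ! p = x} = count (mset w) x"
  by (simp add: count_mset count_list_eq_length_filter length_filter_conv_card eq_commute)

lemma card_ker: "card (ker w) = card (set w)"
  unfolding ker_def
proof (rule card_image, rule inj_onI)
  fix x y
  assume x: "x \<in> set w"
    and eq: "{p. p < length w \<and> w ! p = x} = {p. p < length w \<and> w ! p = y}"
  from x obtain p where "p < length w" "w ! p = x" by (auto simp: in_set_conv_nth)
  then show "x = y" using eq by blast
qed

section \<open>Pairings of a finite set of positions\<close>

lemma ker_in_pair_partitions_iff:
  "ker w \<in> pair_partitions (length w) \<longleftrightarrow> (\<forall>x\<in>set w. count (mset w) x = 2)"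
  using partition_on_ker[of w] by (auto simp: pair_partitions_def ker_def card_level_set)

lemma card_pair_partition:
  assumes "\<pi> \<in> pair_partitions k"
  shows "2 * card \<pi> = k"
proof -
  have p: "partition_on {..<k} \<pi>" and c: "\<And>V. V \<in> \<pi> \<Longrightarrow> card V = 2"
    using assms by (auto simp: pair_partitions_def)
  have "finite \<pi>" using finite_elements[OF _ p] by simp
  moreover have U: "\<Union>\<pi> = {..<k}" using p by (simp add: partition_on_def)
  ultimately have "2 * card \<pi> = card (\<Union>\<pi>)"
    using c partition_onD2[OF p] by (intro card_partition) (auto simp: disjoint_def)
  then show ?thesis using U by simp
qed

lemma finite_pair_partitions: "finite (pair_partitions k)"
  by (rule finite_subset[of _ "Pow (Pow {..<k})"]) (auto simp: pair_partitions_def partition_on_def)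

lemma pair_partitions_odd: "odd k \<Longrightarrow> pair_partitions k = {}"
  using card_pair_partition by fastforce

text \<open>The case of no points supplies the constant terms of the generating functions.\<close>

lemma pair_partitions_0: "pair_partitions 0 = {{}}"
  by (auto simp: pair_partitions_def partition_on_def)

section \<open>Words in which every letter occurs exactly twice\<close>

definition dup_mset :: "'a set \<Rightarrow> 'a multiset" where
  "dup_mset J = mset_set J + mset_set J"

lemma count_dup_mset: "finite J \<Longrightarrow> count (dup_mset J) x = (if x \<in> J then 2 else 0)"
  by (simp add: dup_mset_def count_mset_set')

lemma size_dup_mset: "size (dup_mset J) = 2 * card J"
  by (simp add: dup_mset_def)

lemma set_dup_mset: "finite J \<Longrightarrow> set_mset (dup_mset J) = J"
  by (simp add: dup_mset_def)

lemma image_dup_mset: "inj_on h J \<Longrightarrow> image_mset h (dup_mset J) = dup_mset (h ` J)"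
  by (simp add: dup_mset_def image_mset_mset_set)

text \<open>Bridges two views of the same words: arrangements of doubled letters, which can be
  counted, and words whose kernel is a pairing, which index the sums to be compared.\<close>

lemma mset_eq_dup_mset_iff:
  assumes "finite J"
  shows "mset w = dup_mset J \<longleftrightarrow>
    set w = J \<and> ker w \<in> pair_partitions (length w)"
proof
  assume w: "mset w = dup_mset J"
  then have "set w = J" using set_dup_mset[OF assms] by (metis set_mset_mset)
  then show "set w = J \<and> ker w \<in> pair_partitions (length w)"
    using w assms by (simp add: ker_in_pair_partitions_iff count_dup_mset)
next
  assume w: "set w = J \<and> ker w \<in> pair_partitions (length w)"
  show "mset w = dup_mset J"
  proof (rule multiset_eqI)
    fix x
    show "count (mset w) x = count (dup_mset J) x"
      using w assms by (cases "x \<in> set w") (auto simp: ker_in_pair_partitions_iff count_dup_mset)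
  qed
qed

text \<open>The multinomial coefficient with all multiplicities equal to 2.\<close>

lemma card_permutations_dup_mset:
  assumes "finite J"
  shows "of_nat (card (permutations_of_multiset (dup_mset J))) =
    (fact (2 * card J) / 2 ^ card J :: 'b::field_char_0)"
proof -
  have "(\<Prod>x\<in>set_mset (dup_mset J). fact (count (dup_mset J) x)) = (2 ^ card J :: nat)"
    using assms by (simp add: set_dup_mset count_dup_mset)
  then have "card (permutations_of_multiset (dup_mset J)) * 2 ^ card J = fact (2 * card J)"
    using card_permutations_of_multiset_aux[of "dup_mset J"] by (simp add: size_dup_mset)
  then have "of_nat (card (permutations_of_multiset (dup_mset J)) * 2 ^ card J) = (of_nat (fact (2 * card J)) :: 'b)"
    by simp
  then show ?thesis by (simp add: field_simps)
qed

text \<open>A pairing of \<open>2 * m\<close> points has \<open>m\<close> blocks, and a word with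
  this kernel labels them bijectively by the letters below \<open>m\<close>. One such word
  \<open>w\<close> is fixed; all others arise from it by permuting letters.\<close>

lemma card_words_with_ker:
  assumes \<pi>: "\<pi> \<in> pair_partitions (2 * m)"
  shows "card {w \<in> permutations_of_multiset (dup_mset {..<m}). ker w = \<pi>} = fact m"
proof -
  obtain v :: "nat list" where v: "length v = 2 * m" "ker v = \<pi>"
    using ex_ker[of "2 * m" \<pi>] \<pi> by (auto simp: pair_partitions_def)
  have "card (set v) = m" using card_ker[of v] v card_pair_partition[OF \<pi>] by simp
  then obtain g where g: "bij_betw g (set v) {..<m}"
    using finite_same_card_bij[of "set v" "{..<m}"] by auto
  define w where "w = map g v"
  have setw: "set w = {..<m}" using g by (simp add: w_def bij_betw_def)
  have kerw: "ker w = \<pi>"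
    using g v by (simp add: w_def ker_map_inj bij_betw_def)
  have lenw: "length w = 2 * m" by (simp add: w_def v)
  have "{w \<in> permutations_of_multiset (dup_mset {..<m}). ker w = \<pi>} =
      (\<lambda>\<sigma>. map \<sigma> w) ` {\<sigma>. \<sigma> permutes {..<m}}"
  proof (intro set_eqI iffI)
    fix x assume "x \<in> {w \<in> permutations_of_multiset (dup_mset {..<m}). ker w = \<pi>}"
    then have x: "mset x = dup_mset {..<m}" "ker w = ker x"
      using kerw by (auto dest: permutations_of_multisetD)
    then have setx: "set x = {..<m}" by (simp add: mset_eq_dup_mset_iff)
    obtain h where h: "inj_on h (set w)" "x = map h w" using ker_eq_relabel[OF x(2)] .
    then have "bij_betw h {..<m} {..<m}" using setw setx by (simp add: bij_betw_def)
    \<comment> \<open>\<open>permutes\<close> asks for a map that fixes everything outside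
      \<open>{..<m}\<close>, so \<open>h\<close> is completed by the identity.\<close>
    then have "(\<lambda>i. if i \<in> {..<m} then h i else i) permutes {..<m}"
      using bij_betw_cong[of "{..<m}" "\<lambda>i. if i \<in> {..<m} then h i else i" h "{..<m}"]
      by (intro bij_imp_permutes) simp_all
    moreover have "x = map (\<lambda>i. if i \<in> {..<m} then h i else i) w" using h setw by simp
    ultimately show "x \<in> (\<lambda>\<sigma>. map \<sigma> w) ` {\<sigma>. \<sigma> permutes {..<m}}" by blast
  next
    fix x assume "x \<in> (\<lambda>\<sigma>. map \<sigma> w) ` {\<sigma>. \<sigma> permutes {..<m}}"
    then obtain \<sigma> where \<sigma>: "\<sigma> permutes {..<m}" and x: "x = map \<sigma> w" by blast
    have "inj_on \<sigma> (set w)" using \<sigma> by (metis permutes_inj_on)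
    then have kerx: "ker x = \<pi>" using x kerw by (simp add: ker_map_inj)
    moreover have "set x = {..<m}" using x setw permutes_image[OF \<sigma>] by simp
    moreover have "length x = 2 * m" using x lenw by simp
    ultimately have "mset x = dup_mset {..<m}" using \<pi> by (simp add: mset_eq_dup_mset_iff)
    then show "x \<in> {w \<in> permutations_of_multiset (dup_mset {..<m}). ker w = \<pi>}"
      using kerx by (simp add: permutations_of_multiset_def)
  qed
  moreover have "inj_on (\<lambda>\<sigma>. map \<sigma> w) {\<sigma>. \<sigma> permutes {..<m}}"
  proof (rule inj_onI, rule ext)
    fix \<sigma> \<tau> :: "nat \<Rightarrow> nat" and i
    assume "\<sigma> \<in> {\<sigma>. \<sigma> permutes {..<m}}" "\<tau> \<in> {\<sigma>. \<sigma> permutes {..<m}}" "map \<sigma> w = map \<tau> w"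
    then show "\<sigma> i = \<tau> i" using setw permutes_not_in by (metis map_eq_conv mem_Collect_eq)
  qed
  ultimately show ?thesis by (simp add: card_image card_permutations)
qed

text \<open>Grouping the words by kernel meets every pairing \<open>fact m\<close> times. Sums over
  pairings thereby become sums over words, where products can be expanded.\<close>

lemma sum_pair_partitions:
  fixes T :: "nat set set \<Rightarrow> 'b::{comm_semiring_1, semiring_char_0}"
  shows "(\<Sum>w\<in>permutations_of_multiset (dup_mset {..<m}). T (ker w)) =
    fact m * (\<Sum>\<pi>\<in>pair_partitions (2 * m). T \<pi>)"
proof -
  let ?P = "permutations_of_multiset (dup_mset {..<m})"
  have "ker ` ?P \<subseteq> pair_partitions (2 * m)"
  proof
    fix \<pi> assume "\<pi> \<in> ker ` ?P"
    then obtain w where w: "mset w = dup_mset {..<m}" "\<pi> = ker w"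
      by (auto dest: permutations_of_multisetD)
    then have "length w = 2 * m" by (metis size_mset size_dup_mset card_lessThan)
    then show "\<pi> \<in> pair_partitions (2 * m)" using w by (simp add: mset_eq_dup_mset_iff)
  qed
  then have "(\<Sum>w\<in>?P. T (ker w)) =
      (\<Sum>\<pi>\<in>pair_partitions (2 * m). \<Sum>w | w \<in> ?P \<and> ker w = \<pi>. T (ker w))"
    by (intro sum.group[symmetric] finite_pair_partitions) auto
  also have "\<dots> = (\<Sum>\<pi>\<in>pair_partitions (2 * m). of_nat (fact m) * T \<pi>)"
    by (intro sum.cong refl) (simp add: card_words_with_ker)
  finally show ?thesis by (simp add: sum_distrib_left)
qed

section \<open>Substitution into a power series\<close>

lemma mfps_coeff_times:
  "mfps_coeff (f * g) M = (\<Sum>A | A \<subseteq># M. mfps_coeff f A * mfps_coeff g (M - A))"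
  by transfer simp

lemma mfps_coeff_zero [simp]: "mfps_coeff 0 M = 0"
  by transfer simp

lemma mfps_coeff_one: "mfps_coeff 1 M = (if M = {#} then 1 else 0)"
  by transfer simp

lemma mfps_coeff_add [simp]: "mfps_coeff (f + g) M = mfps_coeff f M + mfps_coeff g M"
  by transfer simp

lemma mfps_coeff_sum [simp]: "mfps_coeff (sum F A) M = (\<Sum>x\<in>A. mfps_coeff (F x) M)"
  by (induction A rule: infinite_finite_induct) simp_all

lemma mfps_coeff_const_times [simp]: "mfps_coeff (mfps_const c * f) M = c * mfps_coeff f M"
proof -
  have "mfps_coeff (mfps_const c * f) M =
      (\<Sum>A | A \<subseteq># M. if A = {#} then c * mfps_coeff f M else 0)"
    unfolding mfps_coeff_times by (intro sum.cong) (auto simp: mfps_const.rep_eq)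
  then show ?thesis by (simp add: finite_submultisets)
qed

lemma mfps_const_0: "mfps_const 0 = 0"
  by (rule mfps_eqI) (simp add: mfps_const.rep_eq)

lemma mfps_const_1: "mfps_const 1 = 1"
  by (rule mfps_eqI) (simp add: mfps_const.rep_eq mfps_coeff_one)

lemma mfps_const_mult: "mfps_const (c * d) = mfps_const c * mfps_const d"
  by (rule mfps_eqI) (simp add: mfps_const.rep_eq)

lemma mfps_const_sum: "mfps_const (sum c A) = (\<Sum>x\<in>A. mfps_const (c x))"
  by (rule mfps_eqI) (simp add: mfps_const.rep_eq)

lemma mfps_const_power: "mfps_const (c ^ n) = mfps_const c ^ n"
  by (induction n) (simp_all add: mfps_const_1 mfps_const_mult)

text \<open>Without a constant term every factor \<open>s\<close> contributes degree at least 1.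
  This keeps all infinite sums below finite at each monomial.\<close>

lemma mfps_coeff_power_eq_0:
  assumes "mfps_coeff s {#} = 0" "size M < n"
  shows "mfps_coeff (s ^ n) M = 0"
  using assms(2)
proof (induction n arbitrary: M)
  case (Suc n)
  have "mfps_coeff s A * mfps_coeff (s ^ n) (M - A) = 0" if "A \<subseteq># M" for A
  proof (cases "A = {#}")
    case False
    then have "size (M - A) < n"
      using Suc.prems that size_mset_mono[OF that]
      by (simp add: size_Diff_submset nonempty_has_size)
    then show ?thesis using Suc.IH by simp
  qed (simp add: assms(1))
  then show ?case by (simp add: mfps_coeff_times)
qed simp

section \<open>Substituting a series into a one-variable series\<close>

lemma mfps_coeff_suminf:
  assumes "finite A" "\<And>n. n \<notin> A \<Longrightarrow> mfps_coeff (F n) M = 0"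
  shows "mfps_coeff (mfps_suminf F) M = (\<Sum>n\<in>A. mfps_coeff (F n) M)"
  unfolding mfps_suminf.rep_eq using assms by (intro Sum_any.expand_superset) auto

definition mfps_compose :: "(nat \<Rightarrow> 'a::comm_ring_1) \<Rightarrow> ('v, 'a) mfps \<Rightarrow> ('v, 'a) mfps" where
  "mfps_compose c s = mfps_suminf (\<lambda>n. mfps_const (c n) * s ^ n)"

lemma mfps_coeff_compose:
  assumes "mfps_coeff s {#} = 0" "size M \<le> N"
  shows "mfps_coeff (mfps_compose c s) M = (\<Sum>n\<le>N. c n * mfps_coeff (s ^ n) M)"
  unfolding mfps_compose_def using assms
  by (subst mfps_coeff_suminf[of "{..N}"]) (auto simp: mfps_coeff_power_eq_0)

text \<open>Substitution is multiplicative, so a product of substituted series is governed by the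
  Cauchy product of their coefficients. At a fixed monomial this reduces to multiplying two
  polynomials in \<open>s\<close>.\<close>

lemma mfps_compose_times:
  fixes s :: "('v, 'a::comm_ring_1) mfps"
  assumes s: "mfps_coeff s {#} = 0"
  shows "mfps_compose c s * mfps_compose d s =
    mfps_compose (\<lambda>n. \<Sum>i\<le>n. c i * d (n - i)) s"
proof (rule mfps_eqI)
  fix M :: "'v multiset"
  define N where "N = size M"
  let ?P = "\<lambda>c. \<Sum>n\<le>N. mfps_const (c n) * s ^ n"
  \<comment> \<open>Monomials of degree at most \<open>N\<close> see only the powers of
    \<open>s\<close> up to \<open>N\<close>, and both parts of a splitting of \<open>M\<close> have
    such a degree.\<close>
  have P: "mfps_coeff (mfps_compose c s) A = mfps_coeff (?P c) A" if "size A \<le> N" for c A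
    using mfps_coeff_compose[OF s that] by simp
  have "mfps_coeff (mfps_compose c s * mfps_compose d s) M = mfps_coeff (?P c * ?P d) M"
    unfolding mfps_coeff_times
    by (intro sum.cong refl arg_cong2[of _ _ _ _ "(*)"] P)
      (auto simp: N_def size_Diff_submset size_mset_mono)
  also have "?P c * ?P d = (\<Sum>(i, j)\<in>{..N} \<times> {..N}. mfps_const (c i * d j) * s ^ (i + j))"
    by (simp add: sum_product sum.cartesian_product mfps_const_mult power_add mult_ac)
  also have "mfps_coeff \<dots> M =
      (\<Sum>(i, j)\<in>{..N} \<times> {..N}. c i * d j * mfps_coeff (s ^ (i + j)) M)"
    by (simp add: case_prod_unfold)
  \<comment> \<open>Powers of \<open>s\<close> beyond \<open>N\<close> do not reach
    \<open>M\<close>, which cuts the square of index pairs down to a triangle.\<close>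
  also have "\<dots> = (\<Sum>(i, j) | i + j \<le> N. c i * d j * mfps_coeff (s ^ (i + j)) M)"
  proof (rule sum.mono_neutral_right)
    show "\<forall>x\<in>{..N} \<times> {..N} - {(i, j). i + j \<le> N}.
        (case x of (i, j) \<Rightarrow> c i * d j * mfps_coeff (s ^ (i + j)) M) = 0"
    proof
      fix x assume "x \<in> {..N} \<times> {..N} - {(i, j). i + j \<le> N}"
      then have "size M < fst x + snd x" by (auto simp: N_def)
      then show "(case x of (i, j) \<Rightarrow> c i * d j * mfps_coeff (s ^ (i + j)) M) = 0"
        by (simp add: split_def mfps_coeff_power_eq_0[OF s])
    qed
  qed auto
  also have "\<dots> = (\<Sum>n\<le>N. \<Sum>i\<le>n. c i * d (n - i) * mfps_coeff (s ^ n) M)"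
    unfolding sum.triangle_reindex_eq[of "\<lambda>i j. c i * d j * mfps_coeff (s ^ (i + j)) M"]
    by simp
  also have "\<dots> = mfps_coeff (mfps_compose (\<lambda>n. \<Sum>i\<le>n. c i * d (n - i)) s) M"
    by (subst mfps_coeff_compose[OF s, of M N]) (simp_all add: N_def sum_distrib_right)
  finally show "mfps_coeff (mfps_compose c s * mfps_compose d s) M =
    mfps_coeff (mfps_compose (\<lambda>n. \<Sum>i\<le>n. c i * d (n - i)) s) M" .
qed

text \<open>Writes the exponential factor as a substitution into the same \<open>s\<close>, ready
  for \<open>mfps_compose_times\<close>.\<close>

lemma mfps_exp_const_times:
  "mfps_exp (mfps_const c * s) = mfps_compose (\<lambda>n. c ^ n / fact n) s"
  unfolding mfps_exp_def mfps_compose_def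
  by (simp add: power_mult_distrib mfps_const_power[symmetric] mult.assoc[symmetric]
      mfps_const_mult[symmetric])

text \<open>A word whose kernel is coarser than \<open>\<pi>\<close> is a free choice of one letter
  per block, so the sum factors over the blocks. For a pairing every factor is the sum of the
  squares.\<close>

lemma sum_words_coarser_than:
  fixes x :: "'i \<Rightarrow> 'b::comm_semiring_1"
  assumes \<pi>: "partition_on {..<k} \<pi>" and R: "finite R"
  shows "(\<Sum>is | length is = k \<and> set is \<subseteq> R \<and> refines {..<k} \<pi> (ker is). prod_list (map x is)) =
    (\<Prod>V\<in>\<pi>. \<Sum>i\<in>R. x i ^ card V)"
proof -
  define B where "B p = (THE V. V \<in> \<pi> \<and> p \<in> V)" for p
  have B_eq: "B p = V" if "V \<in> \<pi>" "p \<in> V" for p V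
    unfolding B_def using that partition_onD2[OF \<pi>]
    by (intro the_equality) (auto simp: disjoint_def)
  have un: "\<Union>\<pi> = {..<k}" using partition_onD1[OF \<pi>] by simp
  have B: "B p \<in> \<pi>" "p \<in> B p" if "p < k" for p
    using that un B_eq by (metis UnionE lessThan_iff)+
  have ne: "V \<noteq> {}" and sub: "V \<subseteq> {..<k}" and fin: "finite V" if "V \<in> \<pi>" for V
    using \<pi> that un finite_subset[of V "{..<k}"] by (auto simp: partition_on_def)
  have fin\<pi>: "finite \<pi>" using finite_elements[OF _ \<pi>] by simp
  have Min: "Min V \<in> V" "Min V < k" if "V \<in> \<pi>" for V
    using Min_in[OF fin ne] that sub by blast+
  have refines_iff: "refines {..<k} \<pi> (ker is) \<longleftrightarrow> (\<forall>V\<in>\<pi>. \<forall>p\<in>V. \<forall>q\<in>V. is ! p = is ! q)"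
    if k: "length is = k" for "is" :: "'i list"
  proof
    assume "refines {..<k} \<pi> (ker is)"
    then show "\<forall>V\<in>\<pi>. \<forall>p\<in>V. \<forall>q\<in>V. is ! p = is ! q"
      unfolding refines_def ker_def by blast
  next
    assume eq: "\<forall>V\<in>\<pi>. \<forall>p\<in>V. \<forall>q\<in>V. is ! p = is ! q"
    have "\<exists>Y\<in>ker is. V \<subseteq> Y" if V: "V \<in> \<pi>" for V
    proof
      show "{q. q < length is \<and> is ! q = is ! Min V} \<in> ker is"
        using Min[OF V] k by (intro block_in_ker) simp
      show "V \<subseteq> {q. q < length is \<and> is ! q = is ! Min V}"
        using eq V sub[OF V] Min(1)[OF V] k by blast
    qed
    then show "refines {..<k} \<pi> (ker is)"
      unfolding refines_def using \<pi> partition_on_ker[of "is"] k by blast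
  qed
  have "(\<Prod>V\<in>\<pi>. \<Sum>i\<in>R. x i ^ card V) = (\<Sum>h\<in>PiE \<pi> (\<lambda>_. R). \<Prod>V\<in>\<pi>. x (h V) ^ card V)"
    by (rule prod_sum_PiE[OF fin\<pi>]) (rule R)
  also have "\<dots> = (\<Sum>is | length is = k \<and> set is \<subseteq> R \<and> refines {..<k} \<pi> (ker is).
      prod_list (map x is))"
  \<comment> \<open>A choice \<open>h\<close> of letters for the blocks is spread over the positions
    by \<open>B\<close>; conversely the letter of a block is read at its least position.
    \<open>restrict\<close> supplies the default value that \<open>PiE\<close> requires off
    \<open>\<pi>\<close>.\<close>
  proof (rule sum.reindex_bij_witness[where j = "\<lambda>h. map (\<lambda>p. h (B p)) [0..<k]"
        and i = "\<lambda>is. restrict (\<lambda>V. is ! Min V) \<pi>"])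
    fix h assume h: "h \<in> PiE \<pi> (\<lambda>_. R)"
    show "restrict (\<lambda>V. map (\<lambda>p. h (B p)) [0..<k] ! Min V) \<pi> = h"
    proof
      fix V
      show "restrict (\<lambda>V. map (\<lambda>p. h (B p)) [0..<k] ! Min V) \<pi> V = h V"
      proof (cases "V \<in> \<pi>")
        case True
        then show ?thesis using Min[OF True] B_eq[OF True Min(1)[OF True]] by simp
      next
        case False
        then show ?thesis using PiE_arb[OF h False] by simp
      qed
    qed
    have "refines {..<k} \<pi> (ker (map (\<lambda>p. h (B p)) [0..<k]))"
    proof (subst refines_iff, simp, intro ballI)
      fix V p q assume "V \<in> \<pi>" "p \<in> V" "q \<in> V"
      moreover from this have "p < k" "q < k" using sub by blast+
      ultimately show "map (\<lambda>p. h (B p)) [0..<k] ! p = map (\<lambda>p. h (B p)) [0..<k] ! q"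
        using B_eq[of V p] B_eq[of V q] by simp
    qed
    moreover have "h (B p) \<in> R" if "p < k" for p using PiE_mem[OF h B(1)[OF that]] .
    ultimately show "map (\<lambda>p. h (B p)) [0..<k] \<in>
        {is. length is = k \<and> set is \<subseteq> R \<and> refines {..<k} \<pi> (ker is)}"
      by auto
    have "prod_list (map x (map (\<lambda>p. h (B p)) [0..<k])) = (\<Prod>p<k. x (h (B p)))"
      by (simp add: comp_def prod.distinct_set_conv_list[symmetric] atLeast0LessThan)
    also have "\<dots> = (\<Prod>p\<in>\<Union>\<pi>. x (h (B p)))" by (simp add: un)
    also have "\<dots> = (\<Prod>V\<in>\<pi>. \<Prod>p\<in>V. x (h (B p)))"
      using fin partition_onD2[OF \<pi>]
      by (subst prod.Union_disjoint) (auto simp: disjoint_def)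
    also have "\<dots> = (\<Prod>V\<in>\<pi>. x (h V) ^ card V)"
      by (intro prod.cong refl) (simp add: B_eq)
    finally show "prod_list (map x (map (\<lambda>p. h (B p)) [0..<k])) = (\<Prod>V\<in>\<pi>. x (h V) ^ card V)" .
  next
    fix "is" assume "is \<in> {is. length is = k \<and> set is \<subseteq> R \<and> refines {..<k} \<pi> (ker is)}"
    then have len: "length is = k" and R: "set is \<subseteq> R"
      and eq: "\<And>V p q. V \<in> \<pi> \<Longrightarrow> p \<in> V \<Longrightarrow> q \<in> V \<Longrightarrow> is ! p = is ! q"
      using refines_iff[of "is"] by blast+
    show "map (\<lambda>p. restrict (\<lambda>V. is ! Min V) \<pi> (B p)) [0..<k] = is"
    proof (rule nth_equalityI)
      fix p assume "p < length (map (\<lambda>p. restrict (\<lambda>V. is ! Min V) \<pi> (B p)) [0..<k])"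
      then have p: "p < k" by simp
      then show "map (\<lambda>p. restrict (\<lambda>V. is ! Min V) \<pi> (B p)) [0..<k] ! p = is ! p"
        using B(1)[OF p] eq[OF B(1)[OF p] Min(1)[OF B(1)[OF p]] B(2)[OF p]] by simp
    qed (simp add: len)
    show "restrict (\<lambda>V. is ! Min V) \<pi> \<in> PiE \<pi> (\<lambda>_. R)"
    proof (rule restrict_PiE_iff[THEN iffD2], rule ballI)
      fix V assume "V \<in> \<pi>"
      then show "is ! Min V \<in> R" using Min(2) len R nth_mem[of "Min V" "is"] by auto
    qed
  qed
  finally show ?thesis by simp
qed

text \<open>Interchanging the sums over words and pairings, each pairing of \<open>k\<close> points
  contributes \<open>s\<close> to the power of its number of blocks, whatever the pairing looks
  like. Hence only the total of \<open>t\<close> over all pairings enters.\<close>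

lemma pairing_functional_gen_fun:
  assumes \<mu>: "is_pairing_functional t \<mu>" and t0: "t {} = 1"
  shows "comm_exp_gen_fun r \<mu> =
    mfps_compose (\<lambda>m. (\<Sum>\<pi>\<in>pair_partitions (2 * m). t \<pi>) / fact (2 * m)) (\<Sum>p<r. mfps_var p ^ 2)"
proof -
  define s :: "(nat, complex) mfps" where "s = (\<Sum>p<r. mfps_var p ^ 2)"
  define T where "T k = (\<Sum>\<pi>\<in>pair_partitions k. t \<pi>) / fact k" for k
  define X where "X k = (\<Sum>is | length is = k \<and> set is \<subseteq> {..<r}.
    mfps_const (\<mu> (prod_list (map nc_var is)) / fact k) * prod_list (map mfps_var is))" for k
  let ?I = "\<lambda>k. {is::nat list. length is = k \<and> set is \<subseteq> {..<r}}"
  have finI: "finite (?I k)" for k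
    using finite_lists_length_eq[of "{..<r}" k] by (simp add: conj_commute)
  \<comment> \<open>For odd \<open>k\<close> there are no pairings and \<open>T k = 0\<close>, so
    the rounding in \<open>k div 2\<close> is harmless.\<close>
  have X: "X k = mfps_const (T k) * s ^ (k div 2)" if k: "k \<ge> 1" for k
  proof -
    have m: "\<mu> (prod_list (map nc_var is)) =
        (\<Sum>\<pi>\<in>pair_partitions k. if refines {..<k} \<pi> (ker is) then t \<pi> else 0)"
      if "length is = k" for "is"
      using \<mu> k that finite_pair_partitions[of k]
      by (simp add: is_pairing_functional_def sum.inter_filter)
    have "X k = (\<Sum>is\<in>?I k. \<Sum>\<pi>\<in>pair_partitions k. if refines {..<k} \<pi> (ker is)
        then mfps_const (t \<pi> / fact k) * prod_list (map mfps_var is) else 0)"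
      unfolding X_def
    proof (intro sum.cong refl)
      fix "is" assume "is \<in> ?I k"
      then have "\<mu> (prod_list (map nc_var is)) / fact k =
          (\<Sum>\<pi>\<in>pair_partitions k. if refines {..<k} \<pi> (ker is) then t \<pi> / fact k else 0)"
        using m by (auto simp: sum_divide_distrib intro!: sum.cong)
      then show "mfps_const (\<mu> (prod_list (map nc_var is)) / fact k) * prod_list (map mfps_var is) =
        (\<Sum>\<pi>\<in>pair_partitions k. if refines {..<k} \<pi> (ker is)
          then mfps_const (t \<pi> / fact k) * prod_list (map mfps_var is) else 0)"
        by (simp add: mfps_const_sum sum_distrib_right) (intro sum.cong, auto simp: mfps_const_0)
    qed
    also have "\<dots> = (\<Sum>\<pi>\<in>pair_partitions k. \<Sum>is\<in>?I k. if refines {..<k} \<pi> (ker is)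
        then mfps_const (t \<pi> / fact k) * prod_list (map mfps_var is) else 0)"
      by (rule sum.swap)
    also have "\<dots> = (\<Sum>\<pi>\<in>pair_partitions k. mfps_const (t \<pi> / fact k) * s ^ (k div 2))"
    proof (intro sum.cong refl)
      fix \<pi> assume \<pi>: "\<pi> \<in> pair_partitions k"
      have "(\<Sum>is\<in>?I k. if refines {..<k} \<pi> (ker is)
          then mfps_const (t \<pi> / fact k) * prod_list (map mfps_var is) else 0) =
          mfps_const (t \<pi> / fact k) * (\<Sum>is | length is = k \<and> set is \<subseteq> {..<r} \<and>
            refines {..<k} \<pi> (ker is). prod_list (map mfps_var is))"
        using finI[of k] by (simp add: sum.inter_filter[symmetric] sum_distrib_left conj_assoc)
      also have "\<dots> = mfps_const (t \<pi> / fact k) * (\<Prod>V\<in>\<pi>. \<Sum>p<r. mfps_var p ^ card V)"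
        using \<pi> by (subst sum_words_coarser_than) (auto simp: pair_partitions_def)
      also have "(\<Prod>V\<in>\<pi>. \<Sum>p<r. mfps_var p ^ card V) = s ^ card \<pi>"
        using \<pi> by (simp add: pair_partitions_def s_def)
      finally show "(\<Sum>is\<in>?I k. if refines {..<k} \<pi> (ker is)
          then mfps_const (t \<pi> / fact k) * prod_list (map mfps_var is) else 0) =
          mfps_const (t \<pi> / fact k) * s ^ (k div 2)"
        using card_pair_partition[OF \<pi>] by auto
    qed
    finally show ?thesis
      by (simp add: T_def sum_divide_distrib mfps_const_sum sum_distrib_right)
  qed
  have s0: "mfps_coeff s {#} = 0"
    by (simp add: s_def power2_eq_square mfps_coeff_times mfps_var.rep_eq)
  have "comm_exp_gen_fun r \<mu> = 1 + mfps_suminf (\<lambda>k. if k = 0 then 0 else X k)"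
    unfolding comm_exp_gen_fun_def X_def ..
  also have "\<dots> = mfps_compose (\<lambda>m. T (2 * m)) s"
  proof (rule mfps_eqI)
    fix M :: "nat multiset"
    \<comment> \<open>Only even lengths \<open>2 * m\<close> with \<open>m \<le> size M\<close> can
      reach the monomial \<open>M\<close>.\<close>
    let ?A = "(\<lambda>m. 2 * m) ` {..size M}"
    have "mfps_coeff (mfps_suminf (\<lambda>k. if k = 0 then 0 else X k)) M =
        (\<Sum>k\<in>?A. mfps_coeff (if k = 0 then 0 else X k) M)"
    proof (rule mfps_coeff_suminf)
      fix k assume k: "k \<notin> ?A"
      show "mfps_coeff (if k = 0 then 0 else X k) M = 0"
      proof (cases "even k")
        case True
        then obtain m where m: "k = 2 * m" by blast
        with k have "size M < m" by auto
        then show ?thesis using m by (simp add: X mfps_coeff_power_eq_0[OF s0])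
      next
        case False
        then show ?thesis by (auto simp: X T_def pair_partitions_odd odd_pos Suc_le_eq)
      qed
    qed simp
    also have "\<dots> = (\<Sum>m\<le>size M. mfps_coeff (if m = 0 then 0 else X (2 * m)) M)"
      by (subst sum.reindex) (auto simp: inj_on_def intro!: sum.cong)
    also have "\<dots> = (\<Sum>m\<in>{..size M} - {0}. T (2 * m) * mfps_coeff (s ^ m) M)"
      by (intro sum.mono_neutral_cong_right) (auto simp: X)
    \<comment> \<open>The separate summand 1 is the term \<open>m = 0\<close> of the substitution,
      because \<open>t {} = 1\<close>.\<close>
    finally show "mfps_coeff (1 + mfps_suminf (\<lambda>k. if k = 0 then 0 else X k)) M =
        mfps_coeff (mfps_compose (\<lambda>m. T (2 * m)) s) M"
      by (simp add: mfps_coeff_compose[OF s0 order_refl] T_def pair_partitions_0 t0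
          sum.remove[of "{..size M}" 0])
  qed
  finally show ?thesis unfolding T_def s_def .
qed

section \<open>Subwords of words with doubled letters\<close>

lemma nths_cong:
  assumes "\<And>i. i < length w \<Longrightarrow> i \<in> A \<longleftrightarrow> i \<in> B"
  shows "nths w A = nths w B"
  unfolding nths_def
  by (rule arg_cong[of _ _ "map fst"], rule filter_cong)
    (auto simp: assms dest!: set_zip_rightD)

lemma nths_insert_ge: "length w \<le> n \<Longrightarrow> nths w (insert n A) = nths w A"
  by (rule nths_cong) auto

lemma nths_snoc: "nths (w @ [x]) A = nths w A @ (if length w \<in> A then [x] else [])"
  by (simp add: nths_append)

lemma mset_nths_Compl: "mset (nths w A) + mset (nths w (- A)) = mset w"
  by (induction w rule: rev_induct) (auto simp: nths_snoc)

text \<open>Peeling letters from the right, the last letter ends exactly one of the two subwords,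
  and \<open>A\<close> decides which.\<close>

lemma nths_Compl_inject:
  assumes "length v = length w" "nths v A = nths w A" "nths v (- A) = nths w (- A)"
  shows "v = w"
  using assms
proof (induction v arbitrary: w rule: rev_induct)
  case (snoc x v)
  then obtain w' y where w: "w = w' @ [y]" by (cases w rule: rev_cases) auto
  then show ?case using snoc.prems snoc.IH[of w'] by (auto simp: nths_snoc split: if_splits)
qed simp

text \<open>The word is rebuilt from the right: its last letter is taken from the end of
  \<open>u\<close> or of \<open>v\<close>, according to whether the last position lies in
  \<open>A\<close>.\<close>

lemma ex_nths_Compl:
  assumes "A \<subseteq> {..<n}" "length u = card A" "length v = n - card A"
  shows "\<exists>w. length w = n \<and> nths w A = u \<and> nths w (- A) = v"
  using assms
proof (induction n arbitrary: A u v)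
  case (Suc n)
  define A' where "A' = A - {n}"
  have sub: "A' \<subseteq> {..<n}" using Suc.prems(1) unfolding A'_def by force
  have fin: "finite A'" using sub finite_lessThan by (rule finite_subset)
  have card: "card A' \<le> n" using card_mono[OF finite_lessThan sub] by simp
  \<comment> \<open>\<open>nths\<close> ignores positions beyond the end, so on words of length
    \<open>n\<close> the sets \<open>A\<close> and \<open>A'\<close> act alike.\<close>
  have cong: "nths w A = nths w A'" "nths w (- A) = nths w (- A')" if "length w = n" for w :: "'a list"
    unfolding A'_def using that by (auto intro!: nths_cong)
  show ?case
  proof (cases "n \<in> A")
    case True
    then have "A = insert n A'" "n \<notin> A'" by (auto simp: A'_def)
    then have c: "card A = Suc (card A')" using card_insert_disjoint[OF fin] by metis
    then obtain u' x where u: "u = u' @ [x]" using Suc.prems(2) by (cases u rule: rev_cases) auto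
    have "length u' = card A'" "length v = n - card A'" using Suc.prems(2,3) c u by simp_all
    then obtain w where w: "length w = n" "nths w A' = u'" "nths w (- A') = v"
      using Suc.IH[OF sub] by blast
    then show ?thesis using True u cong[OF w(1)]
      by (intro exI[of _ "w @ [x]"]) (simp add: nths_snoc)
  next
    case False
    then have eq: "A' = A" by (auto simp: A'_def)
    then obtain v' x where v: "v = v' @ [x]"
      using Suc.prems(3) card by (cases v rule: rev_cases) auto
    have "length u = card A'" "length v' = n - card A'"
      using Suc.prems(2,3) eq v card by simp_all
    then obtain w where w: "length w = n" "nths w A' = u" "nths w (- A') = v'"
      using Suc.IH[OF sub] by blast
    then show ?thesis using False v eq
      by (intro exI[of _ "w @ [x]"]) (simp add: nths_snoc)
  qed
qed simp

text \<open>Allows a sum over arrangements to be reorganised by the subword at fixed positions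
  \<open>A\<close>, with the other letters arranged independently of its order.\<close>

lemma bij_betw_nths_Compl:
  assumes "A \<subseteq> {..<size M}"
  shows "bij_betw (\<lambda>w. (nths w A, nths w (- A))) (permutations_of_multiset M)
    {(u, v). length u = card A \<and> mset u + mset v = M}"
  unfolding bij_betw_def
proof
  have len: "length w = size M" if "w \<in> permutations_of_multiset M" for w
    using that by (auto dest: permutations_of_multisetD)
  show "inj_on (\<lambda>w. (nths w A, nths w (- A))) (permutations_of_multiset M)"
    by (rule inj_onI, rule nths_Compl_inject[of _ _ A]) (auto simp: len)
  show "(\<lambda>w. (nths w A, nths w (- A))) ` permutations_of_multiset M =
      {(u, v). length u = card A \<and> mset u + mset v = M}"
  proof (intro set_eqI iffI)
    fix x assume "x \<in> (\<lambda>w. (nths w A, nths w (- A))) ` permutations_of_multiset M"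
    then obtain w where w: "w \<in> permutations_of_multiset M" "x = (nths w A, nths w (- A))" by blast
    have "{i. i < length w \<and> i \<in> A} = A" using assms len[OF w(1)] by auto
    then show "x \<in> {(u, v). length u = card A \<and> mset u + mset v = M}"
      using w mset_nths_Compl[of w A] by (auto simp: length_nths dest: permutations_of_multisetD)
  next
    fix x assume "x \<in> {(u, v). length u = card A \<and> mset u + mset v = M}"
    then obtain u v where x: "x = (u, v)" "length u = card A" and M: "mset u + mset v = M" by blast
    have "length v = size M - card A" using x M by auto
    then obtain w where w: "nths w A = u" "nths w (- A) = v"
      using ex_nths_Compl[OF assms, of u v] x by blast
    then have "w \<in> permutations_of_multiset M"
      using mset_nths_Compl[of w A] M by (simp add: permutations_of_multiset_def)
    then show "x \<in> (\<lambda>w. (nths w A, nths w (- A))) ` permutations_of_multiset M"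
      using w x by blast
  qed
qed

text \<open>Only subwords using each of their letters twice survive. Such a subword arranges
  \<open>dup_mset J\<close> for its letter set \<open>J\<close>, and the complementary subword is an
  arbitrary arrangement of \<open>dup_mset (I - J)\<close>, which accounts for the numerical
  factor.\<close>

lemma sum_nths_dup_mset:
  fixes G :: "'i list \<Rightarrow> 'b::field_char_0"
  assumes I: "finite I" and A: "A \<subseteq> {..<2 * card I}"
    and G: "\<And>w x. count (mset w) x = 1 \<Longrightarrow> G w = 0"
  shows "(\<Sum>w\<in>permutations_of_multiset (dup_mset I). G (nths w A)) =
    (\<Sum>J | J \<subseteq> I \<and> 2 * card J = card A. fact (2 * (card I - card J)) / 2 ^ (card I - card J) *
      (\<Sum>w\<in>permutations_of_multiset (dup_mset J). G w))"
proof -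
  let ?P = "\<lambda>J. permutations_of_multiset (dup_mset J)"
  let ?Q = "{(u, v). length u = card A \<and> mset u + mset v = dup_mset I}"
  let ?Js = "{J. J \<subseteq> I \<and> 2 * card J = card A}"
  let ?Q' = "\<Union>J\<in>?Js. ?P J \<times> ?P (I - J)"
  have bij: "bij_betw (\<lambda>w. (nths w A, nths w (- A))) (?P I) ?Q"
    using A by (intro bij_betw_nths_Compl) (simp add: size_dup_mset)
  have finJ: "finite J" if "J \<subseteq> I" for J using that I by (rule finite_subset)
  have "(\<Sum>w\<in>?P I. G (nths w A)) = (\<Sum>(u, v)\<in>?Q. G u)"
    using sum.reindex_bij_betw[OF bij, of "\<lambda>(u, v). G u"] by simp
  also have "\<dots> = (\<Sum>(u, v)\<in>?Q'. G u)"
  proof (rule sum.mono_neutral_right)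
    show "finite ?Q" using bij_betw_finite[OF bij] by simp
    show "?Q' \<subseteq> ?Q"
    proof
      fix x assume "x \<in> ?Q'"
      then obtain J u v where x: "x = (u, v)" "J \<in> ?Js" "u \<in> ?P J" "v \<in> ?P (I - J)" by auto
      then have uv: "mset u = dup_mset J" "mset v = dup_mset (I - J)"
        by (auto dest: permutations_of_multisetD)
      have "length u = card A" using x uv(1) size_dup_mset[of J] by (metis (mono_tags, lifting) mem_Collect_eq size_mset)
      moreover have "dup_mset J + dup_mset (I - J) = dup_mset I"
        using x I finJ[of J] by (intro multiset_eqI) (auto simp: count_dup_mset)
      ultimately show "x \<in> ?Q" using x uv by simp
    qed
    show "\<forall>x\<in>?Q - ?Q'. (case x of (u, v) \<Rightarrow> G u) = 0"
    proof (intro ballI, rule ccontr)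
      fix x assume x: "x \<in> ?Q - ?Q'" and ne: "(case x of (u, v) \<Rightarrow> G u) \<noteq> 0"
      then obtain u v where uv: "x = (u, v)" "length u = card A" "mset u + mset v = dup_mset I"
        and u: "G u \<noteq> 0" by auto
      have c: "count (mset u) i + count (mset v) i = (if i \<in> I then 2 else 0)" for i
        using I uv(3) by (metis count_union count_dup_mset)
      \<comment> \<open>The vanishing hypothesis enters here: \<open>u\<close> has no isolated
        letter, and with at most two copies of each letter available, all its letters occur
        twice.\<close>
      have one: "count (mset u) i \<noteq> 1" for i using G u by blast
      have sub: "set u \<subseteq> I"
      proof
        fix i assume "i \<in> set u"
        then show "i \<in> I" using c[of i] by (auto split: if_splits)
      qed
      have cu: "count (mset u) i = (if i \<in> set u then 2 else 0)" for i
      proof (cases "i \<in> set u")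
        case True
        then have "count (mset u) i + count (mset v) i = 2" "count (mset u) i > 0"
          using c[of i] sub by auto
        then have "count (mset u) i = 2" using one[of i] by presburger
        then show ?thesis using True by simp
      next
        case False
        then have "count (mset u) i = 0" by simp
        then show ?thesis using False by simp
      qed
      have mu: "mset u = dup_mset (set u)"
        by (intro multiset_eqI) (simp add: count_dup_mset cu)
      have mv: "mset v = dup_mset (I - set u)"
      proof (rule multiset_eqI)
        fix i
        show "count (mset v) i = count (dup_mset (I - set u)) i"
          using c[of i] cu[of i] sub I by (auto simp: count_dup_mset split: if_splits)
      qed
      have "2 * card (set u) = card A" using mu uv(2) size_dup_mset by (metis size_mset)
      then have "x \<in> ?Q'" using sub mu mv uv(1) by (auto simp: permutations_of_multiset_def)
      then show False using x by blast
    qed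
  qed
  also have "\<dots> = (\<Sum>J\<in>?Js. \<Sum>(u, v)\<in>?P J \<times> ?P (I - J). G u)"
  proof (rule sum.UNION_disjoint)
    show "finite ?Js" using I by simp
    show "\<forall>J\<in>?Js. finite (?P J \<times> ?P (I - J))" by simp
    \<comment> \<open>\<open>J\<close> is recovered as the letter set of the first component, so the
      union is disjoint.\<close>
    have "J = K" if "J \<in> ?Js" "K \<in> ?Js" "x \<in> ?P J" "x \<in> ?P K" for J K x
      using that finJ set_dup_mset by (metis (mono_tags, lifting) mem_Collect_eq permutations_of_multisetD)
    then show "\<forall>J\<in>?Js. \<forall>K\<in>?Js. J \<noteq> K \<longrightarrow> ?P J \<times> ?P (I - J) \<inter> ?P K \<times> ?P (I - K) = {}" by blast
  qed
  also have "\<dots> = (\<Sum>J\<in>?Js. fact (2 * (card I - card J)) / 2 ^ (card I - card J) * (\<Sum>w\<in>?P J. G w))"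
  proof (intro sum.cong refl)
    fix J assume J: "J \<in> ?Js"
    have "(\<Sum>(u, v)\<in>?P J \<times> ?P (I - J). G u) = of_nat (card (?P (I - J))) * (\<Sum>u\<in>?P J. G u)"
      by (simp add: sum.cartesian_product[symmetric] sum_distrib_left)
    then show "(\<Sum>(u, v)\<in>?P J \<times> ?P (I - J). G u) =
        fact (2 * (card I - card J)) / 2 ^ (card I - card J) * (\<Sum>w\<in>?P J. G w)"
      using J I finJ[of J] by (simp add: card_permutations_dup_mset card_Diff_subset)
  qed
  finally show ?thesis .
qed

text \<open>A bijection between the letter sets carries arrangements to arrangements without
  changing \<open>W\<close>, so only the number of doubled letters matters.\<close>

lemma sum_dup_mset_relabel:
  fixes W :: "'i list \<Rightarrow> 'b::comm_monoid_add"
  assumes W: "\<And>h w. inj_on h (set w) \<Longrightarrow> W (map h w) = W w"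
    and fin: "finite J" and card: "card J = card K"
  shows "(\<Sum>w\<in>permutations_of_multiset (dup_mset J). W w) =
    (\<Sum>w\<in>permutations_of_multiset (dup_mset K). W w)"
proof (cases "finite K")
  case False
  \<comment> \<open>For infinite \<open>K\<close> both \<open>card K\<close> and
    \<open>mset_set K\<close> take their default values, so both sides range over arrangements of
    the empty multiset.\<close>
  then have "J = {}" using card fin by simp
  then show ?thesis using False by (simp add: dup_mset_def)
next
  case K: True
  obtain g where g: "bij_betw g K J" using finite_same_card_bij[OF K fin] card by auto
  then have inj: "inj_on g K" and im: "g ` K = J" by (auto simp: bij_betw_def)
  have setK: "set w = K" if "w \<in> permutations_of_multiset (dup_mset K)" for w
    using that set_dup_mset[OF K] by (metis permutations_of_multisetD set_mset_mset)
  have "permutations_of_multiset (dup_mset J) = map g ` permutations_of_multiset (dup_mset K)"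
    using image_dup_mset[OF inj] im by (metis permutations_of_multiset_image)
  moreover have "inj_on (map g) (permutations_of_multiset (dup_mset K))"
    using inj by (intro inj_onI) (auto simp: setK intro: map_inj_on)
  ultimately show ?thesis using inj by (simp add: sum.reindex setK W)
qed

lemma sum_Pow_card:
  fixes g :: "nat \<Rightarrow> 'b::comm_semiring_1"
  assumes "finite A"
  shows "(\<Sum>J\<in>Pow A. g (card J)) = (\<Sum>j\<le>card A. of_nat (card A choose j) * g j)"
proof -
  have "(\<Sum>J\<in>Pow A. g (card J)) = (\<Sum>j\<le>card A. \<Sum>J | J \<in> Pow A \<and> card J = j. g (card J))"
    using assms by (intro sum.group[symmetric]) (auto intro: card_mono)
  also have "\<dots> = (\<Sum>j\<le>card A. of_nat (card A choose j) * g j)"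
    by (intro sum.cong refl) (simp add: n_subsets[OF assms])
  finally show ?thesis .
qed

text \<open>Double count of position sets \<open>A\<close> against surviving letter sets
  \<open>J\<close>. The contribution depends only on \<open>j = card J\<close>, and there are
  \<open>m choose j\<close> letter sets and \<open>2 * m choose (2 * j)\<close> position sets of
  matching size.\<close>

lemma sum_subwords_dup_mset:
  fixes W :: "nat list \<Rightarrow> 'b::field_char_0"
  assumes W0: "\<And>w x. count (mset w) x = 1 \<Longrightarrow> W w = 0"
    and W: "\<And>h w. inj_on h (set w) \<Longrightarrow> W (map h w) = W w"
  shows "(\<Sum>w\<in>permutations_of_multiset (dup_mset {..<m}). \<Sum>A\<in>Pow {..<2 * m}.
      c ^ (2 * m - card A) * W (nths w A)) =
    (\<Sum>j\<le>m. of_nat (m choose j) * (of_nat (2 * m choose (2 * j)) * (c ^ (2 * (m - j)) *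
      (fact (2 * (m - j)) / 2 ^ (m - j)) *
      (\<Sum>w\<in>permutations_of_multiset (dup_mset {..<j}). W w))))"
proof -
  let ?P = "\<lambda>J. permutations_of_multiset (dup_mset J)"
  define K where "K j = fact (2 * (m - j)) / 2 ^ (m - j) * (\<Sum>w\<in>?P {..<j}. W w)" for j
  have "(\<Sum>w\<in>?P {..<m}. \<Sum>A\<in>Pow {..<2 * m}. c ^ (2 * m - card A) * W (nths w A)) =
      (\<Sum>A\<in>Pow {..<2 * m}. c ^ (2 * m - card A) * (\<Sum>w\<in>?P {..<m}. W (nths w A)))"
    by (subst sum.swap) (simp add: sum_distrib_left)
  also have "\<dots> = (\<Sum>A\<in>Pow {..<2 * m}. c ^ (2 * m - card A) *
      (\<Sum>J | J \<subseteq> {..<m} \<and> 2 * card J = card A. K (card J)))"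
  proof (intro sum.cong refl arg_cong2[of _ _ _ _ "(*)"])
    fix A assume "A \<in> Pow {..<2 * m}"
    then have "(\<Sum>w\<in>?P {..<m}. W (nths w A)) =
        (\<Sum>J | J \<subseteq> {..<m} \<and> 2 * card J = card A.
          fact (2 * (m - card J)) / 2 ^ (m - card J) * (\<Sum>w\<in>?P J. W w))"
      using sum_nths_dup_mset[where I = "{..<m}" and A = A and G = W] W0 by simp
    also have "\<dots> = (\<Sum>J | J \<subseteq> {..<m} \<and> 2 * card J = card A. K (card J))"
    proof (intro sum.cong refl)
      fix J assume "J \<in> {J. J \<subseteq> {..<m} \<and> 2 * card J = card A}"
      then have "finite J" by (auto intro: finite_subset)
      then have "(\<Sum>w\<in>?P J. W w) = (\<Sum>w\<in>?P {..<card J}. W w)"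
        by (intro sum_dup_mset_relabel W) simp_all
      then show "fact (2 * (m - card J)) / 2 ^ (m - card J) * (\<Sum>w\<in>?P J. W w) = K (card J)"
        by (simp add: K_def)
    qed
    finally show "(\<Sum>w\<in>?P {..<m}. W (nths w A)) =
      (\<Sum>J | J \<subseteq> {..<m} \<and> 2 * card J = card A. K (card J))" .
  qed
  \<comment> \<open>The size constraint becomes a case distinction so that the two sums range over
    independent sets and can be swapped.\<close>
  also have "\<dots> = (\<Sum>A\<in>Pow {..<2 * m}. \<Sum>J\<in>Pow {..<m}.
      if card A = 2 * card J then c ^ (2 * m - card A) * K (card J) else 0)"
    by (intro sum.cong refl) (auto simp: sum_distrib_left sum.inter_filter[symmetric] intro!: sum.cong)
  also have "\<dots> = (\<Sum>J\<in>Pow {..<m}. \<Sum>A\<in>Pow {..<2 * m}.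
      if card A = 2 * card J then c ^ (2 * m - card A) * K (card J) else 0)"
    by (rule sum.swap)
  also have "\<dots> = (\<Sum>J\<in>Pow {..<m}. of_nat (2 * m choose (2 * card J)) *
      (c ^ (2 * (m - card J)) * K (card J)))"
  proof (intro sum.cong refl)
    fix J :: "nat set"
    have "(\<Sum>A\<in>Pow {..<2 * m}. if card A = 2 * card J then c ^ (2 * m - card A) * K (card J) else 0) =
        (\<Sum>A | A \<subseteq> {..<2 * m} \<and> card A = 2 * card J. c ^ (2 * (m - card J)) * K (card J))"
      by (simp add: sum.inter_filter[symmetric] right_diff_distrib')
    also have "\<dots> = of_nat (2 * m choose (2 * card J)) * (c ^ (2 * (m - card J)) * K (card J))"
      by (simp add: n_subsets)
    finally show "(\<Sum>A\<in>Pow {..<2 * m}. if card A = 2 * card J then c ^ (2 * m - card A) * K (card J) else 0) =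
      of_nat (2 * m choose (2 * card J)) * (c ^ (2 * (m - card J)) * K (card J))" .
  qed
  also have "\<dots> = (\<Sum>j\<le>m. of_nat (m choose j) * (of_nat (2 * m choose (2 * j)) *
      (c ^ (2 * (m - j)) * K j)))"
    by (subst sum_Pow_card) simp_all
  finally show ?thesis by (simp add: K_def mult.assoc)
qed

text \<open>A binomial expansion in a non-commutative algebra: \<open>A\<close> collects the factors
  from which \<open>a i\<close> is taken. Scalars are central, so they move to the front, while
  \<open>nths\<close> keeps the order of the other factors.\<close>

lemma prod_list_add_scalar:
  assumes "star_algebra scale star"
  shows "prod_list (map (\<lambda>i. a i + scale c 1) w) =
    (\<Sum>A\<in>Pow {..<length w}. scale (c ^ (length w - card A)) (prod_list (map a (nths w A))))"
proof -
  interpret star_algebra scale star by fact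
  show ?thesis
  proof (induction w rule: rev_induct)
    case (snoc x w)
    let ?n = "length w"
    let ?p = "\<lambda>A. prod_list (map a (nths w A))"
    have A: "card A \<le> ?n" "finite A" "?n \<notin> A" if "A \<in> Pow {..<?n}" for A
      using that card_mono[of "{..<?n}" A] by (auto intro: finite_subset)
    have inj: "inj_on (insert ?n) (Pow {..<?n})" by (intro inj_onI) (metis A(3) insert_ident)
    \<comment> \<open>Subsets are separated by whether they contain the last position: those without
      it give the factor \<open>scale c 1\<close>, those with it the factor
      \<open>a x\<close>.\<close>
    have "(\<Sum>A\<in>Pow {..<Suc ?n}. scale (c ^ (Suc ?n - card A)) (prod_list (map a (nths (w @ [x]) A)))) =
        (\<Sum>A\<in>Pow {..<?n}. scale (c ^ (Suc ?n - card A)) (prod_list (map a (nths (w @ [x]) A)))) +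
        (\<Sum>A\<in>Pow {..<?n}. scale (c ^ (Suc ?n - card (insert ?n A)))
          (prod_list (map a (nths (w @ [x]) (insert ?n A)))))"
      unfolding lessThan_Suc Pow_insert
      by (subst sum.union_disjoint) (auto simp: sum.reindex[OF inj])
    also have "(\<Sum>A\<in>Pow {..<?n}. scale (c ^ (Suc ?n - card A)) (prod_list (map a (nths (w @ [x]) A)))) =
        (\<Sum>A\<in>Pow {..<?n}. scale (c ^ (?n - card A)) (?p A)) * scale c 1"
      unfolding sum_distrib_right
    proof (intro sum.cong refl)
      fix A assume "A \<in> Pow {..<?n}"
      from A[OF this] show "scale (c ^ (Suc ?n - card A)) (prod_list (map a (nths (w @ [x]) A))) =
          scale (c ^ (?n - card A)) (?p A) * scale c 1"
        by (simp add: nths_snoc Suc_diff_le scale_mult_right[symmetric])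
    qed
    also have "(\<Sum>A\<in>Pow {..<?n}. scale (c ^ (Suc ?n - card (insert ?n A)))
          (prod_list (map a (nths (w @ [x]) (insert ?n A))))) =
        (\<Sum>A\<in>Pow {..<?n}. scale (c ^ (?n - card A)) (?p A)) * a x"
      unfolding sum_distrib_right
    proof (intro sum.cong refl)
      fix A assume "A \<in> Pow {..<?n}"
      from A[OF this] show "scale (c ^ (Suc ?n - card (insert ?n A)))
            (prod_list (map a (nths (w @ [x]) (insert ?n A)))) =
          scale (c ^ (?n - card A)) (?p A) * a x"
        by (simp add: nths_snoc nths_insert_ge scale_mult_left)
    qed
    finally show ?case by (simp add: snoc.IH distrib_left add.commute)
  qed simp
qed

section \<open>Shifting an exchangeable sequence by a scalar\<close>

lemma (in star_algebra) star_one: "star 1 = 1"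
  using star_mult[of "star 1" 1] star_star[of 1] by simp

text \<open>Injective renaming preserves the kernel. The empty word is treated apart because
  \<open>exchangeable\<close> speaks of positive lengths only.\<close>

lemma exchangeable_relabel:
  fixes a :: "nat \<Rightarrow> 'a::ring_1"
  assumes "exchangeable star \<phi> a" "inj_on h (set w)"
  shows "\<phi> (prod_list (map a (map h w))) = \<phi> (prod_list (map a w))"
proof (cases "w = []")
  case False
  then show ?thesis
    using partition_function_ker[OF assms(1), of w] partition_function_ker[OF assms(1), of "map h w"]
      ker_map_inj[OF assms(2)] by simp
qed simp

text \<open>A letter occurring once forms a singleton block of the kernel.\<close>

lemma exchangeable_singleton_vanishing:
  fixes a :: "nat \<Rightarrow> 'a::ring_1"
  assumes ex: "exchangeable star \<phi> a"
    and t: "\<And>k \<pi>. k \<ge> 1 \<Longrightarrow> partition_on {..<k} \<pi> \<Longrightarrow> \<exists>V\<in>\<pi>. card V = 1 \<Longrightarrow>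
      partition_function \<phi> a \<pi> = 0"
    and x: "count (mset w) x = 1"
  shows "\<phi> (prod_list (map a w)) = 0"
proof -
  have "x \<in> set w" using x by (metis count_mset_0_iff zero_neq_one)
  moreover have "card {p. p < length w \<and> w ! p = x} = 1" using x by (simp add: card_level_set)
  ultimately have "\<exists>V\<in>ker w. card V = 1" by (auto simp: ker_def)
  moreover have "w \<noteq> []" using \<open>x \<in> set w\<close> by auto
  ultimately show ?thesis
    using t[OF _ partition_on_ker[of w]] partition_function_ker[OF ex, of w] by (simp add: Suc_le_eq)
qed

text \<open>Only the empty word has an empty kernel, so the choice made by \<open>SOME\<close> is
  forced.\<close>

lemma partition_function_empty: "partition_function \<phi> a {} = \<phi> 1"
proof -
  have "ker [] = ({} :: nat set set)" by (simp add: ker_def)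
  then have "ker (SOME is::nat list. ker is = {}) = {}" by (rule someI)
  then have "(SOME is::nat list. ker is = {}) = []" by (auto simp: ker_def)
  then show ?thesis by (simp add: partition_function_def)
qed

context star_prob_space
begin

lemma state_prod_list_add_scalar:
  "\<phi> (prod_list (map (\<lambda>i. a i + scale c 1) w)) =
    (\<Sum>A\<in>Pow {..<length w}. c ^ (length w - card A) * \<phi> (prod_list (map a (nths w A))))"
proof -
  interpret f: Vector_Spaces.linear scale "(*)" \<phi> by (rule linear_state)
  show ?thesis
    by (simp add: prod_list_add_scalar[OF star_algebra_axioms] f.sum f.scale)
qed

text \<open>Renaming letters commutes with taking subwords, so the expansions for two words with
  equal kernels agree term by term. Selfadjointness uses that \<open>c\<close> is real.\<close>

lemma exchangeable_add_scalar:
  assumes a: "exchangeable star \<phi> a" and c: "c \<in> \<real>"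
  shows "exchangeable star \<phi> (\<lambda>i. a i + scale c 1)"
  unfolding exchangeable_def
proof (intro conjI allI impI)
  show "star (a n + scale c 1) = a n + scale c 1" for n
    using a c by (simp add: exchangeable_def star_add star_scale star_one Reals_cnj_iff)
next
  fix k and v w :: "nat list"
  assume "length v = k \<and> length w = k \<and> ker v = ker w"
  then obtain h where h: "inj_on h (set v)" "w = map h v" by (metis ker_eq_relabel)
  have "\<phi> (prod_list (map a (nths w A))) = \<phi> (prod_list (map a (nths v A)))" for A
    using exchangeable_relabel[OF a, of h "nths v A"] inj_on_subset[OF h(1) set_nths_subset]
    by (simp add: h(2) nths_map)
  then show "\<phi> (prod_list (map (\<lambda>i. a i + scale c 1) v)) = \<phi> (prod_list (map (\<lambda>i. a i + scale c 1) w))"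
    using h(2) unfolding state_prod_list_add_scalar by simp
qed

lemma sum_state_dup_mset:
  assumes "exchangeable star \<phi> a"
  shows "(\<Sum>w\<in>permutations_of_multiset (dup_mset {..<m}). \<phi> (prod_list (map a w))) =
    fact m * (\<Sum>\<pi>\<in>pair_partitions (2 * m). partition_function \<phi> a \<pi>)"
proof -
  have "partition_function \<phi> a (ker w) = \<phi> (prod_list (map a w))" for w
    using partition_function_ker[OF assms, of w] by (cases "w = []") (auto simp: ker_def partition_function_empty)
  then show ?thesis by (simp add: sum_pair_partitions[symmetric])
qed

text \<open>The one-variable identity behind the theorem: the right side is a coefficient of the
  product of the series of \<open>T\<close> with an exponential. Both sides, multiplied by
  \<open>fact m * fact (2 * m)\<close>, are the state summed over the words of \<open>m\<close>
  doubled letters in the shifted sequence.\<close>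

lemma pairing_sum_add_scalar:
  assumes a: "exchangeable star \<phi> a"
    and t: "\<And>k \<pi>. k \<ge> 1 \<Longrightarrow> partition_on {..<k} \<pi> \<Longrightarrow> \<exists>V\<in>\<pi>. card V = 1 \<Longrightarrow>
      partition_function \<phi> a \<pi> = 0"
    and c: "c \<in> \<real>"
  defines "T \<equiv> \<lambda>k. \<Sum>\<pi>\<in>pair_partitions k. partition_function \<phi> a \<pi>"
  shows "(\<Sum>\<pi>\<in>pair_partitions (2 * m). partition_function \<phi> (\<lambda>i. a i + scale c 1) \<pi>) / fact (2 * m) =
    (\<Sum>j\<le>m. T (2 * j) / fact (2 * j) * ((c ^ 2 / 2) ^ (m - j) / fact (m - j)))"
proof -
  let ?P = "\<lambda>m. permutations_of_multiset (dup_mset {..<m})"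
  let ?b = "\<lambda>i. a i + scale c 1"
  have len: "length w = 2 * m" if "w \<in> ?P m" for w
    using that by (metis permutations_of_multisetD size_mset size_dup_mset card_lessThan)
  have "fact m * (\<Sum>\<pi>\<in>pair_partitions (2 * m). partition_function \<phi> ?b \<pi>) =
      (\<Sum>w\<in>?P m. \<phi> (prod_list (map ?b w)))"
    by (rule sum_state_dup_mset[OF exchangeable_add_scalar[OF a c], symmetric])
  also have "\<dots> = (\<Sum>w\<in>?P m. \<Sum>A\<in>Pow {..<2 * m}. c ^ (2 * m - card A) * \<phi> (prod_list (map a (nths w A))))"
    by (intro sum.cong refl) (simp add: state_prod_list_add_scalar len)
  also have "\<dots> = (\<Sum>j\<le>m. of_nat (m choose j) * (of_nat (2 * m choose (2 * j)) * (c ^ (2 * (m - j)) *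
      (fact (2 * (m - j)) / 2 ^ (m - j)) * (fact j * T (2 * j)))))"
    unfolding T_def sum_state_dup_mset[OF a, symmetric]
    by (rule sum_subwords_dup_mset[where W = "\<lambda>w. \<phi> (prod_list (map a w))",
          OF exchangeable_singleton_vanishing[OF a t] exchangeable_relabel[OF a]])
  also have "\<dots> = fact m * fact (2 * m) *
      (\<Sum>j\<le>m. T (2 * j) / fact (2 * j) * ((c ^ 2 / 2) ^ (m - j) / fact (m - j)))"
    unfolding sum_distrib_left
  proof (intro sum.cong refl)
    fix j assume "j \<in> {..m}"
    then have j: "j \<le> m" by simp
    \<comment> \<open>With both binomials written in factorials, \<open>fact j\<close> and
      \<open>fact (2 * (m - j))\<close> cancel against the factors from the word counts.\<close>
    have "of_nat (m choose j) = (fact m / (fact j * fact (m - j)) :: complex)"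
      by (rule binomial_fact[OF j])
    moreover have "of_nat (2 * m choose (2 * j)) =
        (fact (2 * m) / (fact (2 * j) * fact (2 * (m - j))) :: complex)"
      using j binomial_fact[of "2 * j" "2 * m", where ?'a = complex] by (simp add: right_diff_distrib')
    ultimately show "of_nat (m choose j) * (of_nat (2 * m choose (2 * j)) * (c ^ (2 * (m - j)) *
        (fact (2 * (m - j)) / 2 ^ (m - j)) * (fact j * T (2 * j)))) =
      fact m * fact (2 * m) * (T (2 * j) / fact (2 * j) * ((c ^ 2 / 2) ^ (m - j) / fact (m - j)))"
      by (simp only: power_mult power_divide) (simp add: mult_ac)
  qed
  finally show ?thesis by (simp add: field_simps)
qed

end

theorem proposition1p14:
  fixes scale :: "complex \<Rightarrow> 'a::ring_1 \<Rightarrow> 'a"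
    and star :: "'a \<Rightarrow> 'a"
    and \<phi> :: "'a \<Rightarrow> complex"
    and a b :: "nat \<Rightarrow> 'a"
    and l :: real
    and t u :: "nat set set \<Rightarrow> complex"
    and \<mu> \<nu> :: "nat nc_poly \<Rightarrow> complex"
    and r :: nat
  assumes "star_prob_space scale star \<phi>"
    and "exchangeable star \<phi> a"
    and "t = partition_function \<phi> a"
    and "\<And>k \<pi>. k \<ge> 1 \<Longrightarrow> partition_on {..<k} \<pi> \<Longrightarrow> \<exists>V\<in>\<pi>. card V = 1 \<Longrightarrow> t \<pi> = 0"
    and "\<And>n. b n = a n + scale (of_real l) 1"
    and "u = partition_function \<phi> b"
    and "is_pairing_functional t \<mu>"
    and "is_pairing_functional u \<nu>"
    and "r \<ge> 1"
  shows "exchangeable star \<phi> b \<and>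
    comm_exp_gen_fun r \<mu> * mfps_exp (mfps_const (of_real (l ^ 2 / 2)) * (\<Sum>p<r. mfps_var p ^ 2)) =
      comm_exp_gen_fun r \<nu>"
proof
  interpret star_prob_space scale star \<phi> by fact
  have b: "b = (\<lambda>i. a i + scale (of_real l) 1)" using assms(5) by (rule ext)
  show "exchangeable star \<phi> b"
    unfolding b by (rule exchangeable_add_scalar[OF assms(2)]) simp
  define s :: "(nat, complex) mfps" where "s = (\<Sum>p<r. mfps_var p ^ 2)"
  have s0: "mfps_coeff s {#} = 0"
    by (simp add: s_def power2_eq_square mfps_coeff_times mfps_var.rep_eq)
  have t0: "t {} = 1" and u0: "u {} = 1"
    by (simp_all add: assms(3,6) partition_function_empty state_one)
  have pairing_sum: "(\<Sum>\<pi>\<in>pair_partitions (2 * m). u \<pi>) / fact (2 * m) =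
      (\<Sum>j\<le>m. (\<Sum>\<pi>\<in>pair_partitions (2 * j). t \<pi>) / fact (2 * j) *
        (of_real (l ^ 2 / 2) ^ (m - j) / fact (m - j)))" for m
    using pairing_sum_add_scalar[OF assms(2) assms(4)[unfolded assms(3)], where c = "of_real l" and m = m]
    unfolding assms(3,6) b by simp
  \<comment> \<open>All three series are substitutions into the same \<open>s\<close>, so comparing
    coefficients leaves exactly \<open>pairing_sum\<close>.\<close>
  show "comm_exp_gen_fun r \<mu> *
      mfps_exp (mfps_const (of_real (l ^ 2 / 2)) * (\<Sum>p<r. mfps_var p ^ 2)) = comm_exp_gen_fun r \<nu>"
    unfolding pairing_functional_gen_fun[OF assms(7) t0] pairing_functional_gen_fun[OF assms(8) u0]
      s_def[symmetric] mfps_exp_const_times mfps_compose_times[OF s0] pairing_sum ..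
qed

end
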